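(* Let $\omega\in\mathbb{R}^n$ and $0<s_0<1$, and let $\mathbf P$ be a positive, decreasing, integrable function on $J_0=[0,+\infty)$. Let $Z:\mathbb{T}^n\times J_0\to\mathbb{R}^n$ be a time-dependent vector field of the form $Z(q,t)=\omega+P(q,t)$ with $P\in\mathcal{A}^0_{s_0}$ and $|P^t|_{s_0}\le\mathbf P(t)$ for all $t\in J_0$. Then there exists an analytic asymptotic KAM torus $\psi^t$ associated to $(Z,\omega,\mathrm{Id})$.
   Context: $\mathbb{T}^n=\mathbb{R}^n/\mathbb{Z}^n$; $J_\upsilon=[\upsilon,+\infty)$; $P^t(q)=P(q,t)$. For $s>0$, $\mathbb{T}^n_s=\{q\in\mathbb{C}^n/\mathbb{Z}^n:|\operatorname{Im}q|\le s\}$. A real analytic function on $\mathbb{T}^n$ is identified with its real (i.e. real-valued at real points), bounded, holomorphic extension to $\mathbb{T}^n_s$, and $|f|_s=\sup_{z\in\mathbb{T}^n_s}|f(z)|$ (maximum over the components for vector-valued functions). $\mathcal{A}^\upsilon_s$ is the space of functions $f$ continuous on $\mathbb{T}^n_s\times J_\upsilon$ such that $f^t$ is real analytic on $\mathbb{T}^n_s$ for all $t\in J_\upsilon$. Analytic asymptotic KAM torus (on $\mathcal{P}=\mathbb{T}^n$): let $X^t,X_0^t$ be real analytic time-dependent vector fields on $\mathcal{P}$, for all $t\in J_\upsilon$ (some $\upsilon\ge0$), and $\varphi_0:\mathbb{T}^n\to\mathcal{P}$ a real analytic embedding with, for some $s>0$, (i) $\lim_{t\to+\infty}|X^t-X_0^t|_s=0$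 and (ii) $X_0(\varphi_0(q),t)=\partial_q\varphi_0(q)\omega$ for all $(q,t)\in\mathbb{T}^n\times J_\upsilon$. A family of real analytic embeddings $\varphi^t:\mathbb{T}^n\to\mathcal{P}$ is an analytic asymptotic KAM torus associated to $(X,X_0,\varphi_0)$ if there are $0<s'\le s$ and $\upsilon'\ge\upsilon$ such that $\lim_{t\to+\infty}|\varphi^t-\varphi_0|_{s'}=0$ and $X(\varphi(q,t),t)=\partial_q\varphi(q,t)\omega+\partial_t\varphi(q,t)$ for all $(q,t)\in\mathbb{T}^n\times J_{\upsilon'}$, where $\varphi(q,t)=\varphi^t(q)$. Here $X=Z$, $X_0$ is the constant vector field $\omega$ and $\varphi_0=\mathrm{Id}$ is the identity of $\mathbb{T}^n$. *)

theory Defs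
  imports "HOL-Analysis.Analysis"
begin

text \<open>
  The torus \<open>R^n / Z^n\<close> and its complex neighbourhoods are handled through their covering spaces:
  a function on the closed complex strip of width \<open>s\<close> is a total function on \<open>complex ^ 'n\<close>
  of which only the values on \<open>cstrip s\<close> matter.  A real analytic object is represented by its
  holomorphic extension; its values on the real torus are those at the points \<open>cvec q\<close>.
\<close>

definition cvec :: "real ^ 'n \<Rightarrow> complex ^ 'n" where
  "cvec q = (\<chi> i. complex_of_real (q $ i))"

definition int_lattice :: "(complex ^ 'n) set" where
  "int_lattice = {k. \<forall>i. k $ i \<in> \<int>}"

text \<open>The size of the imaginary part is measured in the maximum norm.\<close>

definition cstrip :: "real \<Rightarrow> (complex ^ 'n) set" where
  "cstrip s = {z. \<forall>i. \<bar>Im (z $ i)\<bar> \<le> s}"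

text \<open>Holomorphy in several variables: a complex linear Frechet derivative at every point of an
  open set.\<close>

definition holomorphic_vec_on ::
    "(complex ^ 'n \<Rightarrow> complex ^ 'm) \<Rightarrow> (complex ^ 'n) set \<Rightarrow> bool" where
  "holomorphic_vec_on f S \<longleftrightarrow>
     (\<forall>z\<in>S. \<exists>D. (f has_derivative D) (at z) \<and> (\<forall>c v. D (c *s v) = c *s D v))"

text \<open>On the closed strip, holomorphic means continuous up to the boundary and holomorphic in the
  interior.\<close>

definition real_holomorphic_strip :: "real \<Rightarrow> (complex ^ 'n \<Rightarrow> complex ^ 'm) \<Rightarrow> bool" where
  "real_holomorphic_strip s f \<longleftrightarrow>
     continuous_on (cstrip s) f \<and>
     holomorphic_vec_on f (interior (cstrip s)) \<and>
     (\<forall>q i. f (cvec q) $ i \<in> \<real>)"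

text \<open>Vector-valued functions (equivalently, vector fields) on the torus.\<close>

definition real_analytic_fun :: "real \<Rightarrow> (complex ^ 'n \<Rightarrow> complex ^ 'm) \<Rightarrow> bool" where
  "real_analytic_fun s f \<longleftrightarrow>
     real_holomorphic_strip s f \<and>
     bounded (f ` cstrip s) \<and>
     (\<forall>z\<in>cstrip s. \<forall>k\<in>int_lattice. f (z + k) = f z)"

text \<open>The supremum is taken in \<open>ennreal\<close>, so that it is meaningful (and infinite) for
  unbounded functions.\<close>

definition strip_norm :: "real \<Rightarrow> (complex ^ 'n \<Rightarrow> complex ^ 'm) \<Rightarrow> ennreal" where
  "strip_norm s f = (SUP z\<in>cstrip s. SUP i. ennreal (norm (f z $ i)))"

definition analytic_space :: "real \<Rightarrow> real \<Rightarrow> (complex ^ 'n \<Rightarrow> real \<Rightarrow> complex ^ 'm) set" where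
  "analytic_space \<upsilon> s =
     {f. continuous_on (cstrip s \<times> {\<upsilon>..}) (\<lambda>(q, t). f q t) \<and>
         (\<forall>t\<ge>\<upsilon>. real_analytic_fun s (\<lambda>q. f q t))}"

text \<open>A real analytic embedding of the torus into itself is represented by a lift to the
  covering space.  As the torus is compact, an embedding is an injective immersion; injectivity
  is modulo the lattice.\<close>

definition real_analytic_embedding :: "real \<Rightarrow> (complex ^ 'n \<Rightarrow> complex ^ 'n) \<Rightarrow> bool" where
  "real_analytic_embedding s \<phi> \<longleftrightarrow>
     real_holomorphic_strip s \<phi> \<and>
     (\<forall>z\<in>cstrip s. \<forall>k\<in>int_lattice. \<phi> (z + k) - \<phi> z \<in> int_lattice) \<and>
     (\<forall>q q'. \<phi> (cvec q) - \<phi> (cvec q') \<in> int_lattice \<longrightarrow> cvec q - cvec q' \<in> int_lattice) \<and>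
     (\<forall>q v. frechet_derivative \<phi> (at (cvec q)) (cvec v) = 0 \<longrightarrow> v = 0)"

text \<open>The standing assumptions on the data \<open>(X, X\<^sub>0, \<phi>\<^sub>0)\<close>, with \<open>X\<close> and \<open>X\<^sub>0\<close> given on the strip
  of width \<open>s\<close> for times in \<open>[\<upsilon>, \<infinity>)\<close>.\<close>

definition KAM_data ::
    "real \<Rightarrow> real \<Rightarrow> real ^ 'n \<Rightarrow> (complex ^ 'n \<Rightarrow> real \<Rightarrow> complex ^ 'n) \<Rightarrow>
     (complex ^ 'n \<Rightarrow> real \<Rightarrow> complex ^ 'n) \<Rightarrow> (complex ^ 'n \<Rightarrow> complex ^ 'n) \<Rightarrow> bool" where
  "KAM_data \<upsilon> s \<omega> X X\<^sub>0 \<phi>\<^sub>0 \<longleftrightarrow>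
     0 \<le> \<upsilon> \<and> 0 < s \<and>
     (\<forall>t\<ge>\<upsilon>. real_analytic_fun s (\<lambda>q. X q t) \<and> real_analytic_fun s (\<lambda>q. X\<^sub>0 q t)) \<and>
     real_analytic_embedding s \<phi>\<^sub>0 \<and>
     ((\<lambda>t. strip_norm s (\<lambda>q. X q t - X\<^sub>0 q t)) \<longlongrightarrow> 0) at_top \<and>
     (\<forall>q. \<forall>t\<ge>\<upsilon>. X\<^sub>0 (\<phi>\<^sub>0 (cvec q)) t = frechet_derivative \<phi>\<^sub>0 (at (cvec q)) (cvec \<omega>))"

text \<open>The last conjunct is the invariance equation
  \<open>X (\<phi> q t) t = \<partial>\<^sub>q\<phi> q t \<omega> + \<partial>\<^sub>t\<phi> q t\<close>, including the existence of \<open>\<partial>\<^sub>t\<phi>\<close> (one-sided at the initial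
  time); \<open>\<partial>\<^sub>q\<phi>\<close> exists by analyticity.\<close>

definition analytic_asymptotic_KAM_torus ::
    "real \<Rightarrow> real \<Rightarrow> real ^ 'n \<Rightarrow> (complex ^ 'n \<Rightarrow> real \<Rightarrow> complex ^ 'n) \<Rightarrow>
     (complex ^ 'n \<Rightarrow> real \<Rightarrow> complex ^ 'n) \<Rightarrow> (complex ^ 'n \<Rightarrow> complex ^ 'n) \<Rightarrow>
     (complex ^ 'n \<Rightarrow> real \<Rightarrow> complex ^ 'n) \<Rightarrow> bool" where
  "analytic_asymptotic_KAM_torus \<upsilon> s \<omega> X X\<^sub>0 \<phi>\<^sub>0 \<phi> \<longleftrightarrow>
     KAM_data \<upsilon> s \<omega> X X\<^sub>0 \<phi>\<^sub>0 \<and>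
     (\<exists>s' \<upsilon>'. 0 < s' \<and> s' \<le> s \<and> \<upsilon> \<le> \<upsilon>' \<and>
        (\<forall>t\<ge>\<upsilon>'. real_analytic_embedding s' (\<lambda>q. \<phi> q t)) \<and>
        ((\<lambda>t. strip_norm s' (\<lambda>q. \<phi> q t - \<phi>\<^sub>0 q)) \<longlongrightarrow> 0) at_top \<and>
        (\<forall>q. \<forall>t\<ge>\<upsilon>'. \<exists>d.
           ((\<lambda>\<tau>. \<phi> (cvec q) \<tau>) has_vector_derivative d) (at t within {\<upsilon>'..}) \<and>
           X (\<phi> (cvec q) t) t =
             frechet_derivative (\<lambda>x. \<phi> x t) (at (cvec q)) (cvec \<omega>) + d))"

end

theory Submission
  imports Defs "HOL-Complex_Analysis.Cauchy_Integral_Formula"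
begin

text \<open>
  A torus of the form \<open>\<phi>(q, t) = q + u(q, t)\<close> satisfies the invariance equation exactly if
  \<open>\<partial>\<^sub>t u + \<partial>\<^sub>q u \<omega> = P(q + u, t)\<close>.  Along the characteristics \<open>q + t \<omega>\<close> of the linear flow the
  transport term disappears: with \<open>v(q, t) = u(q + t \<omega>, t)\<close> and \<open>F(q, t) = P(q + t \<omega>, t)\<close> the equation
  becomes \<open>\<partial>\<^sub>t v = F(q + v, t)\<close>, an ordinary differential equation with parameter \<open>q\<close>.  The condition
  \<open>u \<rightarrow> 0\<close> prescribes the value of \<open>v\<close> at infinite time, so \<open>v\<close> is a fixed point of
  \<open>v \<mapsto> - \<integral>\<^sub>t\<^sup>\<infinity> F(q + v(q, \<tau>), \<tau>) d\<tau>\<close>.  There are no small divisors and there is no iterated loss of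
  analyticity.

  On a strip narrower than that of \<open>P\<close>, Cauchy's estimate bounds the Lipschitz constant of \<open>F\<close> at
  time \<open>\<tau>\<close> by a multiple of \<open>\<^bold>P(\<tau>)\<close> (\<open>holomorphic_strip_lipschitz\<close>).  As \<open>\<^bold>P\<close> is integrable, the
  integral operator is a contraction for the supremum norm as soon as only late times \<open>t \<ge> \<upsilon>\<close> are
  considered (\<open>picard_contraction\<close>).

  That the fixed point is holomorphic in \<open>q\<close> rests on one statement,
  \<open>holomorphic_vec_on_integral\<close>: an integral of holomorphic maps under an integrable bound is
  holomorphic.  It is applied to Lebesgue measure, for the integral operator, and to the counting
  measure, for the limit of the iterates written as a telescoping series.

  Going back to \<open>u(q, t) = v(q - t \<omega>, t)\<close>, the time derivative at fixed \<open>q\<close> needs a chain rule although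
  \<open>v\<close> is not known to be jointly differentiable; the Lipschitz estimate applied to
  \<open>v(\<cdot>, \<tau>) - v(\<cdot>, t)\<close> provides it (\<open>has_vector_derivative_along_translation\<close>).  Finally, \<open>u\<close> is bounded by
  the tail of the integral of \<open>\<^bold>P\<close>, hence tends to \<open>0\<close> and, again by Cauchy's estimate, is a
  perturbation of the identity with Lipschitz constant at most one half, whence an embedding
  (\<open>near_identity_embedding\<close>).
\<close>

section \<open>Holomorphic maps of several variables and Cauchy estimates\<close>

lemma norm_vector_scalar_mult:
  fixes v :: "complex ^ 'n"
  shows "norm (c *s v) = norm c * norm v"
  by (simp add: norm_vec_def norm_mult L2_set_right_distrib)

lemma norm_le_CARD_mult:
  fixes v :: "complex ^ 'n"
  assumes "\<And>i. norm (v $ i) \<le> B"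
  shows "norm v \<le> real CARD('n) * B"
proof -
  have "norm v \<le> (\<Sum>i\<in>UNIV. norm (v $ i))"
    by (simp add: norm_vec_def L2_set_le_sum)
  also have "\<dots> \<le> (\<Sum>i\<in>(UNIV::'n set). B)"
    by (intro sum_mono assms)
  finally show ?thesis by simp
qed

lemma bounded_linear_complex_line:
  fixes h :: "complex ^ 'n"
  shows "bounded_linear (\<lambda>\<zeta>. \<zeta> *s h)"
  by (rule bounded_linear_intro[where K = "norm h"])
     (simp_all add: norm_vector_scalar_mult vec_eq_iff algebra_simps)

lemma slice_has_field_derivative:
  fixes f :: "complex ^ 'n \<Rightarrow> complex ^ 'm"
  assumes D: "(f has_derivative D) (at (z + \<zeta> *s h))"
    and lin: "\<And>c v. D (c *s v) = c *s D v"
  shows "((\<lambda>\<zeta>. f (z + \<zeta> *s h) $ i) has_field_derivative D h $ i) (at \<zeta>)"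
proof -
  have "((\<lambda>\<zeta>. z + \<zeta> *s h) has_derivative (\<lambda>\<eta>. 0 + \<eta> *s h)) (at \<zeta>)"
    by (intro has_derivative_add has_derivative_const
        bounded_linear_imp_has_derivative bounded_linear_complex_line)
  then have "((\<lambda>\<zeta>. f (z + \<zeta> *s h)) has_derivative (\<lambda>\<eta>. D (0 + \<eta> *s h))) (at \<zeta>)"
    by (rule has_derivative_compose) (use D in simp)
  then have "((\<lambda>\<zeta>. f (z + \<zeta> *s h) $ i) has_derivative (\<lambda>\<eta>. D (0 + \<eta> *s h) $ i)) (at \<zeta>)"
    by (rule bounded_linear.has_derivative[OF bounded_linear_vec_nth])
  moreover have "(\<lambda>\<eta>. D (0 + \<eta> *s h) $ i) = (*) (D h $ i)"
    by (simp add: lin fun_eq_iff mult.commute)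
  ultimately show ?thesis by (simp add: has_field_derivative_def)
qed

text \<open>For the second estimate, the second derivative on the unit disc is bounded by Cauchy's
  inequality on circles of radius \<open>R / 3\<close>; these stay inside the disc of radius \<open>R\<close> because
  \<open>1 + R / 3 < R\<close>.\<close>
lemma Cauchy_first_second_order:
  fixes g :: "complex \<Rightarrow> complex"
  assumes hol: "g holomorphic_on ball 0 R" and R: "R > 0"
    and M: "\<And>x. norm x < R \<Longrightarrow> norm (g x) \<le> M"
  shows "norm (deriv g 0) \<le> 2 * M / R"
    and "2 \<le> R \<Longrightarrow> norm (g 1 - g 0 - deriv g 0) \<le> 18 * M / R\<^sup>2"
proof -
  have C: "norm ((deriv ^^ n) g x) \<le> fact n * M / r ^ n" if "0 < r" "norm x + r < R" for n x r
  proof (rule Cauchy_inequality)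
    have sub: "cball x r \<subseteq> ball 0 R"
    proof
      fix y assume "y \<in> cball x r"
      then show "y \<in> ball 0 R"
        using that(2) norm_triangle_ineq[of x "y - x"] by (simp add: dist_norm norm_minus_commute)
    qed
    show "g holomorphic_on ball x r"
      by (rule holomorphic_on_subset[OF hol]) (use sub in auto)
    show "continuous_on (cball x r) g"
      using holomorphic_on_imp_continuous_on[OF hol] sub by (rule continuous_on_subset)
    show "norm (g y) \<le> M" if "norm (x - y) = r" for y
      using that sub by (intro M) (auto simp: dist_norm subset_iff)
  qed fact
  show "norm (deriv g 0) \<le> 2 * M / R"
    using C[of "R / 2" 0 1] R by (simp add: field_simps)
  assume R2: "2 \<le> R"
  have "norm (g 1 - (\<Sum>i\<le>1. (deriv ^^ i) g 0 * (1 - 0) ^ i / fact i))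
      \<le> (18 * M / R\<^sup>2) * norm (1 - 0 :: complex) ^ Suc 1 / fact 1"
  proof (rule complex_Taylor[where S = "cball 0 1" and f = "\<lambda>i. (deriv ^^ i) g", simplified funpow_0])
    fix i x assume x: "x \<in> cball (0::complex) 1"
    have "((deriv ^^ i) g) field_differentiable at x"
      using holomorphic_higher_deriv[OF hol open_ball] x R2
      by (auto intro!: holomorphic_on_imp_differentiable_at[of _ "ball 0 R"])
    then show "((deriv ^^ i) g has_field_derivative (deriv ^^ Suc i) g x) (at x within cball 0 1)"
      by (auto simp: DERIV_deriv_iff_field_differentiable intro: has_field_derivative_at_within)
  next
    fix x assume x: "x \<in> cball (0::complex) 1"
    have "norm ((deriv ^^ 2) g x) \<le> fact 2 * M / (R / 3) ^ 2"
      by (rule C) (use x R2 in auto)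
    then show "norm ((deriv ^^ Suc 1) g x) \<le> 18 * M / R\<^sup>2"
      by (simp add: power2_eq_square numeral_2_eq_2 mult_ac)
  qed auto
  then show "norm (g 1 - g 0 - deriv g 0) \<le> 18 * M / R\<^sup>2"
    by (simp add: algebra_simps)
qed

text \<open>Both estimates come from the complex line through \<open>z\<close> in direction \<open>h\<close>, on which each component
  of \<open>f\<close> is a holomorphic function of one variable in a disc of radius \<open>r / norm h\<close>.  The remainder
  is bounded by the supremum of \<open>f\<close> alone, which is what survives an integration over a family of
  maps.\<close>
lemma Cauchy_Frechet:
  fixes f :: "complex ^ 'n \<Rightarrow> complex ^ 'm"
  assumes hol: "holomorphic_vec_on f (ball z r)" and r: "0 < r"
    and M: "\<And>w. w \<in> ball z r \<Longrightarrow> norm (f w) \<le> M"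
    and D: "(f has_derivative D) (at z)" and lin: "\<And>c v. D (c *s v) = c *s D v"
  shows "norm (D h) \<le> real CARD('m) * (2 * M / r * norm h)"
    and "norm h \<le> r / 2 \<Longrightarrow>
      norm (f (z + h) - f z - D h) \<le> real CARD('m) * (18 * M / r\<^sup>2 * (norm h)\<^sup>2)"
proof -
  have *: "norm (D h $ i) \<le> 2 * M / r * norm h \<and>
    (norm h \<le> r / 2 \<longrightarrow> norm ((f (z + h) - f z - D h) $ i) \<le> 18 * M / r\<^sup>2 * (norm h)\<^sup>2)" for i
  proof (cases "h = 0")
    case True
    then show ?thesis
      using linear_0[OF has_derivative_linear[OF D]] by simp
  next
    case False
    define R where "R = r / norm h"
    define g where "g = (\<lambda>\<zeta>. f (z + \<zeta> *s h) $ i)"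
    have R: "0 < R" using r False by (simp add: R_def)
    have inball: "z + \<zeta> *s h \<in> ball z r" if "norm \<zeta> < R" for \<zeta>
      using that False by (simp add: dist_norm norm_vector_scalar_mult R_def field_simps)
    have holg: "g holomorphic_on ball 0 R"
    proof (rule holomorphic_onI)
      fix \<zeta> :: complex assume "\<zeta> \<in> ball 0 R"
      then obtain D' where D': "(f has_derivative D') (at (z + \<zeta> *s h))"
          "\<And>c v. D' (c *s v) = c *s D' v"
        using hol inball[of \<zeta>] unfolding holomorphic_vec_on_def by (metis mem_ball_0)
      show "g field_differentiable (at \<zeta> within ball 0 R)"
        unfolding g_def using slice_has_field_derivative[OF D']
        by (meson field_differentiable_at_within field_differentiable_def)
    qed
    have Mg: "norm (g \<zeta>) \<le> M" if "norm \<zeta> < R" for \<zeta>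
      unfolding g_def using M[OF inball[OF that]] Finite_Cartesian_Product.norm_nth_le order_trans
      by blast
    have "(g has_field_derivative D h $ i) (at 0)"
      unfolding g_def by (rule slice_has_field_derivative) (use D lin in auto)
    then have dg: "deriv g 0 = D h $ i" by (rule DERIV_imp_deriv)
    note C = Cauchy_first_second_order[OF holg R Mg, unfolded dg]
    have "2 \<le> R" if "norm h \<le> r / 2"
      using that False by (simp add: R_def field_simps)
    then show ?thesis
      using C False by (auto simp: g_def R_def power_divide)
  qed
  show "norm (D h) \<le> real CARD('m) * (2 * M / r * norm h)"
    by (rule norm_le_CARD_mult) (use * in blast)
  show "norm (f (z + h) - f z - D h) \<le> real CARD('m) * (18 * M / r\<^sup>2 * (norm h)\<^sup>2)"
    if "norm h \<le> r / 2"
    by (rule norm_le_CARD_mult) (use * that in blast)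
qed

lemma has_derivative_quadratic:
  fixes f :: "'a::real_normed_vector \<Rightarrow> 'b::real_normed_vector"
  assumes D: "bounded_linear D" and r: "0 < r"
    and C: "\<And>h. norm h \<le> r \<Longrightarrow> norm (f (z + h) - f z - D h) \<le> C * (norm h)\<^sup>2"
  shows "(f has_derivative D) (at z)"
  unfolding has_derivative_at
proof (intro conjI D)
  show "(\<lambda>h. norm (f (z + h) - f z - D h) / norm h) \<midarrow>0\<rightarrow> 0"
  proof (rule Lim_null_comparison)
    show "\<forall>\<^sub>F h in at 0. norm (norm (f (z + h) - f z - D h) / norm h) \<le> C * norm h"
      unfolding eventually_at
      using C r by (intro exI[of _ r]) (auto simp: field_simps power2_eq_square)
    show "((\<lambda>h. C * norm h) \<longlongrightarrow> 0) (at 0)"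
      by (auto intro!: tendsto_eq_intros)
  qed
qed

lemma norm_integral_le:
  fixes f :: "'a \<Rightarrow> 'b::{banach, second_countable_topology}"
  assumes "integrable M f" "integrable M g" "\<And>x. norm (f x) \<le> g x"
  shows "norm (\<integral>x. f x \<partial>M) \<le> (\<integral>x. g x \<partial>M)"
  using assms by (intro order_trans[OF integral_norm_bound] integral_mono integrable_norm)

text \<open>The candidate for the derivative of the integral is the integral of the derivatives; integrating
  the quadratic remainder estimate over the family shows that it is the derivative.  The map
  \<open>x \<mapsto> D\<^sub>x h\<close> is measurable because \<open>D\<^sub>x h\<close> is a limit of difference quotients.\<close>
lemma holomorphic_vec_on_integral:
  fixes f :: "'a \<Rightarrow> complex ^ 'n \<Rightarrow> complex ^ 'm"
  assumes S: "open S"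
    and hol: "\<And>x. holomorphic_vec_on (f x) S"
    and bound: "\<And>x w. w \<in> S \<Longrightarrow> norm (f x w) \<le> b x"
    and b: "integrable M b"
    and meas: "\<And>w. w \<in> S \<Longrightarrow> (\<lambda>x. f x w) \<in> borel_measurable M"
  shows "holomorphic_vec_on (\<lambda>w. \<integral>x. f x w \<partial>M) S"
  unfolding holomorphic_vec_on_def
proof
  fix z assume z: "z \<in> S"
  then obtain r where r: "0 < r" "ball z r \<subseteq> S"
    using S by (meson open_contains_ball)
  have "\<exists>D. \<forall>x. (f x has_derivative D x) (at z) \<and> (\<forall>c v. D x (c *s v) = c *s D x v)"
    using hol z unfolding holomorphic_vec_on_def by (intro choice) blast
  then obtain D where D: "\<And>x. (f x has_derivative D x) (at z)"
    and lin: "\<And>x c v. D x (c *s v) = c *s D x v" by blast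
  note est = Cauchy_Frechet[OF _ r(1) _ D lin, of _ "b _"]
  have holb: "holomorphic_vec_on (f x) (ball z r)" for x
    using hol r(2) by (auto simp: holomorphic_vec_on_def)
  have est1: "norm (D x h) \<le> real CARD('m) * (2 * b x / r * norm h)" for x h
    using r(2) bound by (intro est(1) holb) auto
  have est2: "norm (f x (z + h) - f x z - D x h) \<le> real CARD('m) * (18 * b x / r\<^sup>2 * (norm h)\<^sup>2)"
    if "norm h \<le> r / 2" for x h
    using r(2) bound that by (intro est(2) holb) auto
  have bl: "bounded_linear (D x)" for x using D by (rule has_derivative_bounded_linear)
  have intf: "integrable M (\<lambda>x. f x w)" if "w \<in> S" for w
    using meas[OF that] bound[OF that]
    by (intro Bochner_Integration.integrable_bound[OF b])
       (auto intro!: AE_I2 order_trans[OF _ abs_ge_self])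
  have intD: "integrable M (\<lambda>x. D x h)" for h
  proof (rule Bochner_Integration.integrable_bound)
    show "integrable M (\<lambda>x. real CARD('m) * (2 * b x / r * norm h))"
      using b by simp
    show "AE x in M. norm (D x h) \<le> norm (real CARD('m) * (2 * b x / r * norm h))"
      using est1[of _ h] by (intro AE_I2) (metis order_trans abs_ge_self real_norm_def)
    \<comment> \<open>The steps \<open>1 / (n + N)\<close> are so short that the difference quotients stay inside the ball.\<close>
    obtain N :: nat where N: "norm h / r < real N" "0 < N"
      using reals_Archimedean2[of "max 1 (norm h / r)"] by auto
    let ?e = "\<lambda>n. inverse (real (n + N))"
    have inS: "z + ?e n *\<^sub>R h \<in> S" for n
    proof -
      have "norm h / r < real (n + N)" using N by simp
      then have "norm h < r * real (n + N)" using r by (simp add: field_simps)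
      then have "norm (?e n *\<^sub>R h) < r" using N(2) by (simp add: field_simps)
      then show ?thesis using r(2) by (auto simp: dist_norm subset_iff)
    qed
    show "(\<lambda>x. D x h) \<in> borel_measurable M"
    proof (rule borel_measurable_LIMSEQ_metric)
      show "(\<lambda>x. real (n + N) *\<^sub>R (f x (z + ?e n *\<^sub>R h) - f x z)) \<in> borel_measurable M" for n
        using meas[OF inS[of n]] meas[OF z] by measurable
      show "(\<lambda>n. real (n + N) *\<^sub>R (f x (z + ?e n *\<^sub>R h) - f x z)) \<longlonglongrightarrow> D x h" for x
      proof -
        have e0: "(\<lambda>n. ?e n) \<longlonglongrightarrow> 0"
          using LIMSEQ_ignore_initial_segment[OF lim_inverse_n, of N] by simp
        let ?K = "real CARD('m) * (18 * b x / r\<^sup>2 * (norm h)\<^sup>2)"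
        have "(\<lambda>n. ?e n *\<^sub>R h) \<longlonglongrightarrow> 0 *\<^sub>R h"
          by (intro tendsto_intros e0)
        from tendstoD[OF this, of "r / 2"] r(1)
        have "\<forall>\<^sub>F n in sequentially. norm (?e n *\<^sub>R h) < r / 2" by simp
        then have "\<forall>\<^sub>F n in sequentially.
            norm (real (n + N) *\<^sub>R (f x (z + ?e n *\<^sub>R h) - f x z) - D x h) \<le> ?K * ?e n"
        proof eventually_elim
          case (elim n)
          have p: "0 < real (n + N)" using N by simp
          have "real (n + N) *\<^sub>R (f x (z + ?e n *\<^sub>R h) - f x z) - D x h
              = real (n + N) *\<^sub>R (f x (z + ?e n *\<^sub>R h) - f x z - D x (?e n *\<^sub>R h))"
            using p by (simp add: linear_simps[OF bl] scaleR_diff_right del: of_nat_add)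
          also have "norm \<dots> \<le> real (n + N) * (real CARD('m) * (18 * b x / r\<^sup>2 * (norm (?e n *\<^sub>R h))\<^sup>2))"
            unfolding norm_scaleR[of "real (n + N)"] abs_of_nat
            by (intro mult_left_mono est2 less_imp_le[OF elim] of_nat_0_le_iff)
          also have "\<dots> = ?K * ?e n"
            using p by (simp add: power2_eq_square field_simps del: of_nat_add)
          finally show ?case .
        qed
        then have "(\<lambda>n. real (n + N) *\<^sub>R (f x (z + ?e n *\<^sub>R h) - f x z) - D x h) \<longlonglongrightarrow> 0"
          by (rule Lim_null_comparison) (intro tendsto_mult_right_zero e0)
        then show ?thesis by (simp add: LIM_zero_iff)
      qed
    qed
  qed
  define E where "E = (\<lambda>h. \<integral>x. D x h \<partial>M)"
  have "bounded_linear E"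
  proof (rule bounded_linear_intro)
    show "E (h + k) = E h + E k" for h k
      by (simp add: E_def linear_simps[OF bl] intD)
    show "E (c *\<^sub>R h) = c *\<^sub>R E h" for c h
      by (simp add: E_def linear_simps[OF bl] intD)
    show "norm (E h) \<le> norm h * (\<integral>x. real CARD('m) * (2 * b x / r) \<partial>M)" for h
    proof -
      have "norm (E h) \<le> (\<integral>x. norm h * (real CARD('m) * (2 * b x / r)) \<partial>M)"
        unfolding E_def using est1[of _ h] b
        by (intro norm_integral_le intD) (auto simp: mult_ac)
      then show ?thesis by simp
    qed
  qed
  moreover have "norm ((\<integral>x. f x (z + h) \<partial>M) - (\<integral>x. f x z \<partial>M) - E h)
      \<le> (\<integral>x. real CARD('m) * (18 * b x / r\<^sup>2) \<partial>M) * (norm h)\<^sup>2" if h: "norm h \<le> r / 2" for h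
  proof -
    have "z + h \<in> S" using h r by (auto simp: dist_norm subset_iff)
    note i = intf[OF this] intf[OF z] intD[of h]
    have "norm (\<integral>x. f x (z + h) - f x z - D x h \<partial>M)
        \<le> (\<integral>x. real CARD('m) * (18 * b x / r\<^sup>2) * (norm h)\<^sup>2 \<partial>M)"
      using est2[OF h] i b
      by (intro norm_integral_le) (auto simp: mult_ac)
    then show ?thesis using i by (simp add: E_def)
  qed
  ultimately have "((\<lambda>w. \<integral>x. f x w \<partial>M) has_derivative E) (at z)"
    using r by (intro has_derivative_quadratic[where r = "r / 2"]) (assumption, simp)
  moreover have "E (c *s v) = c *s E v" for c v
  proof -
    have "bounded_linear (\<lambda>w::complex ^ 'm. c *s w)"
      by (rule bounded_linear_intro[where K = "norm c"])
         (simp_all add: norm_vector_scalar_mult vec_eq_iff algebra_simps)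
    then show ?thesis
      unfolding E_def lin by (rule integral_bounded_linear[OF _ intD])
  qed
  ultimately show "\<exists>D. ((\<lambda>w. \<integral>x. f x w \<partial>M) has_derivative D) (at z) \<and> (\<forall>c v. D (c *s v) = c *s D v)"
    by blast
qed

lemma holomorphic_vec_on_subset:
  "holomorphic_vec_on f T \<Longrightarrow> S \<subseteq> T \<Longrightarrow> holomorphic_vec_on f S"
  by (auto simp: holomorphic_vec_on_def)

lemma holomorphic_vec_on_cong:
  assumes "holomorphic_vec_on f S" "open S" "\<And>z. z \<in> S \<Longrightarrow> f z = g z"
  shows "holomorphic_vec_on g S"
  unfolding holomorphic_vec_on_def
proof
  fix z assume z: "z \<in> S"
  then obtain D where D: "(f has_derivative D) (at z)" "\<forall>c v. D (c *s v) = c *s D v"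
    using assms(1) unfolding holomorphic_vec_on_def by meson
  have "(g has_derivative D) (at z)"
    using D(1) assms(2) z assms(3) by (rule has_derivative_transform_within_open)
  with D(2) show "\<exists>D. (g has_derivative D) (at z) \<and> (\<forall>c v. D (c *s v) = c *s D v)"
    by blast
qed

lemma holomorphic_vec_on_const: "holomorphic_vec_on (\<lambda>z. c) S"
  unfolding holomorphic_vec_on_def by (intro ballI exI[of _ "\<lambda>h. 0"]) (auto simp: vec_eq_iff)

lemma holomorphic_vec_on_id: "holomorphic_vec_on (\<lambda>z. z) S"
  unfolding holomorphic_vec_on_def by (intro ballI exI[of _ "\<lambda>h. h"]) auto

lemma holomorphic_vec_on_add:
  assumes "holomorphic_vec_on f S" "holomorphic_vec_on g S"
  shows "holomorphic_vec_on (\<lambda>z. f z + g z) S"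
  unfolding holomorphic_vec_on_def
proof
  fix z assume "z \<in> S"
  then obtain D E where "(f has_derivative D) (at z)" "\<forall>c v. D (c *s v) = c *s D v"
      "(g has_derivative E) (at z)" "\<forall>c v. E (c *s v) = c *s E v"
    using assms unfolding holomorphic_vec_on_def by meson
  then show "\<exists>D. ((\<lambda>z. f z + g z) has_derivative D) (at z) \<and> (\<forall>c v. D (c *s v) = c *s D v)"
    by (intro exI[of _ "\<lambda>h. D h + E h"])
       (auto intro!: has_derivative_add simp: vec_eq_iff algebra_simps)
qed

lemma holomorphic_vec_on_minus:
  assumes "holomorphic_vec_on f S"
  shows "holomorphic_vec_on (\<lambda>z. - f z) S"
  unfolding holomorphic_vec_on_def
proof
  fix z assume "z \<in> S"
  then obtain D where "(f has_derivative D) (at z)" "\<forall>c v. D (c *s v) = c *s D v"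
    using assms unfolding holomorphic_vec_on_def by meson
  then show "\<exists>D. ((\<lambda>z. - f z) has_derivative D) (at z) \<and> (\<forall>c v. D (c *s v) = c *s D v)"
    by (intro exI[of _ "\<lambda>h. - D h"])
       (auto intro!: has_derivative_minus simp: vec_eq_iff algebra_simps)
qed

lemma holomorphic_vec_on_diff:
  assumes "holomorphic_vec_on f S" "holomorphic_vec_on g S"
  shows "holomorphic_vec_on (\<lambda>z. f z - g z) S"
  using holomorphic_vec_on_add[OF assms(1) holomorphic_vec_on_minus[OF assms(2)]] by simp

lemma holomorphic_vec_on_compose:
  assumes f: "holomorphic_vec_on f S" and g: "holomorphic_vec_on g T" and "\<And>z. z \<in> S \<Longrightarrow> f z \<in> T"
  shows "holomorphic_vec_on (\<lambda>z. g (f z)) S"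
  unfolding holomorphic_vec_on_def
proof
  fix z assume "z \<in> S"
  then obtain D E where "(f has_derivative D) (at z)" "\<forall>c v. D (c *s v) = c *s D v"
      "(g has_derivative E) (at (f z))" "\<forall>c v. E (c *s v) = c *s E v"
    using assms unfolding holomorphic_vec_on_def by meson
  then show "\<exists>D. ((\<lambda>z. g (f z)) has_derivative D) (at z) \<and> (\<forall>c v. D (c *s v) = c *s D v)"
    by (intro exI[of _ "\<lambda>h. E (D h)"]) (auto intro: has_derivative_compose)
qed

lemma holomorphic_vec_on_imp_continuous_on:
  assumes "holomorphic_vec_on f S" shows "continuous_on S f"
  using assms unfolding holomorphic_vec_on_def
  by (meson continuous_at_imp_continuous_on has_derivative_continuous)

section \<open>Open strips\<close>

definition ostrip :: "real \<Rightarrow> (complex ^ 'n) set" where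
  "ostrip s = {z. \<forall>i. \<bar>Im (z $ i)\<bar> < s}"

lemma open_ostrip: "open (ostrip s :: (complex ^ 'n) set)"
proof -
  have "ostrip s = (\<Inter>i. {z :: complex ^ 'n. \<bar>Im (z $ i)\<bar> < s})"
    by (auto simp: ostrip_def)
  also have "open \<dots>"
    by (intro open_INT ballI open_Collect_less continuous_intros) auto
  finally show ?thesis .
qed

lemma convex_ostrip: "convex (ostrip s :: (complex ^ 'n) set)"
  unfolding convex_alt
proof (intro ballI allI impI)
  fix x y :: "complex ^ 'n" and u :: real
  assume *: "x \<in> ostrip s" "y \<in> ostrip s" "0 \<le> u \<and> u \<le> 1"
  have "\<bar>Im (((1 - u) *\<^sub>R x + u *\<^sub>R y) $ i)\<bar> < s" for i
  proof -
    have "\<bar>Im (x $ i)\<bar> < s" "\<bar>Im (y $ i)\<bar> < s" using * by (auto simp: ostrip_def)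
    then have "(1 - u) *\<^sub>R Im (x $ i) + u *\<^sub>R Im (y $ i) \<in> ball 0 s"
      using * by (intro convexD_alt[OF convex_ball]) auto
    then show ?thesis by simp
  qed
  then show "(1 - u) *\<^sub>R x + u *\<^sub>R y \<in> ostrip s" by (simp add: ostrip_def)
qed

lemma ostrip_mono: "s \<le> t \<Longrightarrow> ostrip s \<subseteq> ostrip t"
  unfolding ostrip_def using order_less_le_trans by blast

lemma cstrip_subset_ostrip: "s < t \<Longrightarrow> cstrip s \<subseteq> ostrip t"
  unfolding cstrip_def ostrip_def using order_le_less_trans by blast

lemma ostrip_subset_interior_cstrip: "ostrip s \<subseteq> interior (cstrip s)"
  by (rule interior_maximal[OF _ open_ostrip])
     (use less_imp_le in \<open>auto simp: cstrip_def ostrip_def\<close>)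

lemma ostrip_add:
  assumes "z \<in> ostrip s" "norm h \<le> r"
  shows "z + h \<in> ostrip (s + r)"
  unfolding ostrip_def
proof (intro CollectI allI)
  fix i
  have "\<bar>Im (h $ i)\<bar> \<le> r"
    using abs_Im_le_cmod[of "h $ i"] Finite_Cartesian_Product.norm_nth_le[of h i] assms(2) by linarith
  moreover have "\<bar>Im (z $ i)\<bar> < s" using assms(1) by (auto simp: ostrip_def)
  ultimately show "\<bar>Im ((z + h) $ i)\<bar> < s + r" by simp
qed

lemma ball_subset_ostrip:
  assumes "z \<in> ostrip s"
  shows "ball z r \<subseteq> ostrip (s + r)"
proof
  fix y assume "y \<in> ball z r"
  then show "y \<in> ostrip (s + r)"
    using ostrip_add[OF assms, of "y - z" r] by (simp add: dist_norm norm_minus_commute)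
qed

lemma ostrip_add_real: "(\<And>i. k $ i \<in> \<real>) \<Longrightarrow> z + k \<in> ostrip s \<longleftrightarrow> z \<in> ostrip s"
  by (simp add: ostrip_def complex_is_Real_iff)

lemma int_lattice_real: "k \<in> int_lattice \<Longrightarrow> k $ i \<in> \<real>"
  unfolding int_lattice_def by (metis (mono_tags) Ints_cases Reals_of_int mem_Collect_eq)

lemma cvec_real: "cvec q $ i \<in> \<real>"
  by (simp add: cvec_def)

lemma real_vec_cases:
  assumes "\<And>i. z $ i \<in> \<real>" obtains q where "z = cvec q"
  using that[of "\<chi> i. Re (z $ i)"] assms by (simp add: cvec_def vec_eq_iff)

lemma cvec_in_ostrip: "0 < s \<Longrightarrow> cvec q \<in> ostrip s"
  by (simp add: ostrip_def cvec_def)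

lemma cvec_diff: "cvec (q - q') = cvec q - cvec q'"
  by (simp add: cvec_def vec_eq_iff)

lemma cvec_scaleR: "cvec (t *\<^sub>R \<omega>) = t *\<^sub>R cvec \<omega>"
  by (simp add: cvec_def vec_eq_iff complex_eq_iff)

lemma cvec_eq_0_iff: "cvec v = 0 \<longleftrightarrow> v = 0"
  by (simp add: cvec_def vec_eq_iff)

text \<open>Cauchy's estimate bounds the derivative, and the strip is convex.  This trade of width for a
  Lipschitz constant proportional to the supremum drives the contraction, the embedding property
  and the chain rule in time.\<close>
lemma holomorphic_strip_lipschitz:
  fixes f :: "complex ^ 'n \<Rightarrow> complex ^ 'm"
  assumes hol: "holomorphic_vec_on f (ostrip (s + r))" and r: "0 < r"
    and M: "\<And>w. w \<in> ostrip (s + r) \<Longrightarrow> norm (f w) \<le> M"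
    and zw: "z \<in> ostrip s" "w \<in> ostrip s"
  shows "norm (f z - f w) \<le> real CARD('m) * (2 * M / r) * norm (z - w)"
proof -
  have "\<forall>x. \<exists>D. x \<in> ostrip s \<longrightarrow> (f has_derivative D) (at x) \<and> (\<forall>c v. D (c *s v) = c *s D v)"
    using hol ostrip_mono[of s "s + r"] r unfolding holomorphic_vec_on_def
    by (meson less_eq_real_def less_add_same_cancel1 subsetD)
  then obtain D where D: "\<And>x. x \<in> ostrip s \<Longrightarrow> (f has_derivative D x) (at x)"
    and lin: "\<And>x c v. x \<in> ostrip s \<Longrightarrow> D x (c *s v) = c *s D x v"
    by metis
  note ball = ball_subset_ostrip[of _ s r]
  show ?thesis
  proof (rule differentiable_bound[OF convex_ostrip _ _ zw])
    fix x :: "complex ^ 'n" assume x: "x \<in> ostrip s"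
    show "(f has_derivative D x) (at x within ostrip s)"
      using D[OF x] by (rule has_derivative_at_withinI)
    show "onorm (D x) \<le> real CARD('m) * (2 * M / r)"
    proof (rule onorm_bound)
      have "0 \<le> M" using M[of x] ball[OF x] r by (meson centre_in_ball norm_ge_zero order_trans subsetD)
      then show "0 \<le> real CARD('m) * (2 * M / r)" using r by simp
      show "norm (D x h) \<le> real CARD('m) * (2 * M / r) * norm h" for h
        using Cauchy_Frechet(1)[OF holomorphic_vec_on_subset[OF hol ball[OF x]] r
            M[OF subsetD[OF ball[OF x]]] D[OF x] lin[OF x], of h]
        by (simp add: mult.assoc)
    qed
  qed
qed

section \<open>Tail integrals\<close>

definition tail :: "(real \<Rightarrow> 'a::euclidean_space) \<Rightarrow> real \<Rightarrow> 'a" where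
  "tail f t = (LINT \<tau>:{t..}|lborel. f \<tau>)"

lemma set_integrable_tail:
  fixes f :: "real \<Rightarrow> 'a::euclidean_space"
  shows "set_integrable lborel {a..} f \<Longrightarrow> a \<le> t \<Longrightarrow> set_integrable lborel {t..} f"
  by (rule set_integrable_subset) auto

lemma tail_split:
  fixes f :: "real \<Rightarrow> 'a::euclidean_space"
  assumes f: "set_integrable lborel {a..} f" and t: "a \<le> t"
  shows "tail f a = integral {a..t} f + tail f t"
proof -
  have "set_integrable lborel {a..t} f" by (rule set_integrable_subset[OF f]) auto
  note i = set_borel_integral_eq_integral(1)[OF this]
    set_borel_integral_eq_integral[OF set_integrable_tail[OF f t]]
    set_borel_integral_eq_integral[OF f]
  have "{a..} = {a..t} \<union> {t..}" "{a..t} \<inter> {t..} = {t}" using t by auto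
  then show ?thesis
    unfolding tail_def i(3,5) by (simp add: integral_Un i(1,2))
qed

lemma tail_norm_le:
  fixes f :: "real \<Rightarrow> 'a::euclidean_space"
  assumes "set_integrable lborel {t..} f" "set_integrable lborel {t..} g"
    and "\<And>\<tau>. t \<le> \<tau> \<Longrightarrow> norm (f \<tau>) \<le> g \<tau>"
  shows "norm (tail f t) \<le> tail g t"
  unfolding tail_def
  using assms by (intro order_trans[OF set_integral_norm_bound] set_integral_mono) (auto intro: set_integrable_norm)

lemma tail_tendsto_0:
  fixes f :: "real \<Rightarrow> 'a::euclidean_space"
  assumes f: "set_integrable lborel {a..} f"
  shows "(tail f \<longlongrightarrow> 0) at_top"
proof -
  have "((\<lambda>t. LINT \<tau>:{a..t}|lborel. f \<tau>) \<longlongrightarrow> tail f a) at_top"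
    unfolding tail_def by (rule tendsto_set_lebesgue_integral_at_top) (use f in auto)
  then have "((\<lambda>t. tail f a - (LINT \<tau>:{a..t}|lborel. f \<tau>)) \<longlongrightarrow> tail f a - tail f a) at_top"
    by (intro tendsto_intros)
  moreover have "\<forall>\<^sub>F t in at_top. tail f a - (LINT \<tau>:{a..t}|lborel. f \<tau>) = tail f t"
    using eventually_ge_at_top[of a]
  proof eventually_elim
    case (elim t)
    have "set_integrable lborel {a..t} f" by (rule set_integrable_subset[OF f]) auto
    then show ?case
      using tail_split[OF f elim] by (simp add: set_borel_integral_eq_integral(2))
  qed
  ultimately show ?thesis using tendsto_cong by force
qed

text \<open>The derivative formula below requires a continuous integrand; the majorant of the perturbation
  is merely integrable, and for it continuity of the tail has to suffice.\<close>
lemma tail_continuous_on: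
  fixes f :: "real \<Rightarrow> 'a::euclidean_space"
  assumes f: "set_integrable lborel {a..} f"
  shows "continuous_on {a..} (tail f)"
  unfolding continuous_on_eq_continuous_within
proof
  fix t assume t: "t \<in> {a..}"
  have eq: "tail f u = tail f a - integral {a..u} f" if "a \<le> u" for u
    using tail_split[OF f that] by simp
  have "f integrable_on {a..t + 1}"
    by (rule set_borel_integral_eq_integral(1), rule set_integrable_subset[OF f]) auto
  then have "continuous_on {a..t + 1} (\<lambda>u. tail f a - integral {a..u} f)"
    by (intro continuous_intros indefinite_integral_continuous_1)
  then have "continuous_on {a..t + 1} (tail f)"
    by (rule continuous_on_eq) (rule eq[symmetric], simp)
  moreover have "at t within {a..t + 1} = at t within {a..}"
    by (rule at_within_nhd[of _ "{..<t+1}"]) auto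
  ultimately show "continuous (at t within {a..}) (tail f)"
    using t by (auto simp: continuous_on_eq_continuous_within dest!: bspec[of _ _ t])
qed

lemma tail_has_vector_derivative:
  fixes f :: "real \<Rightarrow> 'a::euclidean_space"
  assumes f: "set_integrable lborel {a..} f" and c: "continuous_on {a..} f" and t: "a \<le> t"
  shows "(tail f has_vector_derivative - f t) (at t within {a..})"
proof -
  have eq: "tail f u = tail f a - integral {a..u} f" if "a \<le> u" for u
    using tail_split[OF f that] by simp
  have "((\<lambda>u. integral {a..u} f) has_vector_derivative f t) (at t within {a..t + 1})"
    using t by (intro integral_has_vector_derivative continuous_on_subset[OF c]) auto
  then have "((\<lambda>u. tail f a - integral {a..u} f) has_vector_derivative 0 - f t) (at t within {a..t + 1})"
    by (intro derivative_intros) auto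
  then have "(tail f has_vector_derivative 0 - f t) (at t within {a..t + 1})"
    by (rule has_vector_derivative_transform[rotated 2]) (use t in simp, rule eq, simp)
  moreover have "at t within {a..t + 1} = at t within {a..}"
    by (rule at_within_nhd[of _ "{..<t+1}"]) auto
  ultimately show ?thesis by simp
qed

lemma tail_real_component:
  fixes f :: "real \<Rightarrow> complex ^ 'n"
  assumes f: "set_integrable lborel {t..} f" and r: "\<And>\<tau>. t \<le> \<tau> \<Longrightarrow> f \<tau> $ i \<in> \<real>"
  shows "tail f t $ i \<in> \<real>"
proof -
  have bl: "bounded_linear (\<lambda>z :: complex ^ 'n. Im (z $ i))"
    by (rule bounded_linear_compose[OF bounded_linear_Im bounded_linear_vec_nth])
  have "Im (tail f t $ i) = (\<integral>\<tau>. Im ((indicator {t..} \<tau> *\<^sub>R f \<tau>) $ i) \<partial>lborel)"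
    using integral_bounded_linear[OF bl f[unfolded set_integrable_def]]
    by (simp add: tail_def set_lebesgue_integral_def)
  also have "(\<lambda>\<tau>. Im ((indicator {t..} \<tau> *\<^sub>R f \<tau>) $ i)) = (\<lambda>\<tau>. 0)"
    using r by (auto simp: indicator_def complex_is_Real_iff)
  finally show ?thesis by (simp add: complex_is_Real_iff)
qed

section \<open>Solutions that vanish at infinite time\<close>

text \<open>The perturbation seen along the linear flow.  Of the four layers of width \<open>\<rho>\<close>, one is spent on the
  Lipschitz constant of \<open>F\<close>, one on the displacement \<open>v\<close>, and one on the Lipschitz constant of \<open>v\<close>; the
  last one carries the torus.  Cauchy's estimate together with the condition \<open>small\<close> makes
  the time integral of the Lipschitz constant of \<open>F\<close>, and the Lipschitz constant of \<open>v\<close>, at most one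
  half.\<close>
locale integrable_field =
  fixes F :: "complex ^ 'n \<Rightarrow> real \<Rightarrow> complex ^ 'n" and b :: "real \<Rightarrow> real" and \<rho> \<upsilon> :: real
  assumes rho: "0 < \<rho>"
    and cont: "continuous_on (ostrip (4 * \<rho>) \<times> {\<upsilon>..}) (\<lambda>(q, t). F q t)"
    and hol: "\<And>t. \<upsilon> \<le> t \<Longrightarrow> holomorphic_vec_on (\<lambda>q. F q t) (ostrip (4 * \<rho>))"
    and bound: "\<And>q t. q \<in> ostrip (4 * \<rho>) \<Longrightarrow> \<upsilon> \<le> t \<Longrightarrow> norm (F q t) \<le> b t"
    and b_int: "set_integrable lborel {\<upsilon>..} b"
    and per: "\<And>q k t. q \<in> ostrip (4 * \<rho>) \<Longrightarrow> k \<in> int_lattice \<Longrightarrow> \<upsilon> \<le> t \<Longrightarrow> F (q + k) t = F q t"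
    and real: "\<And>q i t. \<upsilon> \<le> t \<Longrightarrow> F (cvec q) t $ i \<in> \<real>"
    and small: "4 * real CARD('n) * tail b \<upsilon> \<le> \<rho>"
begin

lemma b_nonneg: "\<upsilon> \<le> t \<Longrightarrow> 0 \<le> b t"
  using bound[of "cvec 0" t] cvec_in_ostrip[of "4 * \<rho>" 0] rho
  by (meson mult_pos_pos norm_ge_zero order_trans zero_less_numeral)

lemma tail_b_antimono: "\<upsilon> \<le> t \<Longrightarrow> t \<le> t' \<Longrightarrow> tail b t' \<le> tail b t"
  using tail_split[OF set_integrable_tail[OF b_int], of t t'] b_nonneg
  by (auto intro!: Henstock_Kurzweil_Integration.integral_nonneg
      set_borel_integral_eq_integral(1) set_integrable_subset[OF b_int])

lemma tail_b_nonneg: "\<upsilon> \<le> t \<Longrightarrow> 0 \<le> tail b t"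
  unfolding tail_def set_lebesgue_integral_def
  by (intro Bochner_Integration.integral_nonneg) (auto simp: indicator_def b_nonneg)

lemma tail_b_le: "tail b \<upsilon> \<le> \<rho> / 4"
proof -
  have "1 * tail b \<upsilon> \<le> real CARD('n) * tail b \<upsilon>"
    using tail_b_nonneg[of \<upsilon>] by (intro mult_right_mono) auto
  then show ?thesis using small by simp
qed

text \<open>A class of displacements preserved by the integral operator and by the limit of its iterates.
  Periodicity and reality are carried along because the limit inherits them from the iterates.\<close>
definition admissible :: "(complex ^ 'n \<Rightarrow> real \<Rightarrow> complex ^ 'n) \<Rightarrow> bool" where
  "admissible u \<longleftrightarrow>
    (\<forall>q\<in>ostrip (2 * \<rho>). continuous_on {\<upsilon>..} (u q)) \<and>
    (\<forall>q\<in>ostrip (2 * \<rho>). \<forall>t\<ge>\<upsilon>. norm (u q t) \<le> \<rho>) \<and>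
    (\<forall>t\<ge>\<upsilon>. holomorphic_vec_on (\<lambda>q. u q t) (ostrip (2 * \<rho>))) \<and>
    (\<forall>q\<in>ostrip (2 * \<rho>). \<forall>k\<in>int_lattice. \<forall>t\<ge>\<upsilon>. u (q + k) t = u q t) \<and>
    (\<forall>q i. \<forall>t\<ge>\<upsilon>. u (cvec q) t $ i \<in> \<real>)"

definition picard :: "(complex ^ 'n \<Rightarrow> real \<Rightarrow> complex ^ 'n) \<Rightarrow> complex ^ 'n \<Rightarrow> real \<Rightarrow> complex ^ 'n" where
  "picard u q t = - tail (\<lambda>\<tau>. F (q + u q \<tau>) \<tau>) t"

context
  fixes u :: "complex ^ 'n \<Rightarrow> real \<Rightarrow> complex ^ 'n"
  assumes u: "admissible u"
begin

lemma shifted_in_ostrip: "q \<in> ostrip (2 * \<rho>) \<Longrightarrow> \<upsilon> \<le> t \<Longrightarrow> q + u q t \<in> ostrip (3 * \<rho>)"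
  using ostrip_add[of q "2 * \<rho>" "u q t" \<rho>] u by (simp add: admissible_def)

lemma shifted_in_ostrip4: "q \<in> ostrip (2 * \<rho>) \<Longrightarrow> \<upsilon> \<le> t \<Longrightarrow> q + u q t \<in> ostrip (4 * \<rho>)"
  using shifted_in_ostrip ostrip_mono[of "3 * \<rho>" "4 * \<rho>"] rho by auto

lemma integrand_continuous:
  assumes q: "q \<in> ostrip (2 * \<rho>)"
  shows "continuous_on {\<upsilon>..} (\<lambda>\<tau>. F (q + u q \<tau>) \<tau>)"
proof -
  have "continuous_on {\<upsilon>..} (\<lambda>\<tau>. (q + u q \<tau>, \<tau>))"
    using u q by (intro continuous_intros) (auto simp: admissible_def)
  from continuous_on_compose2[OF cont this] show ?thesis
    using shifted_in_ostrip4[OF q] by auto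
qed

lemma integrand_bound: "q \<in> ostrip (2 * \<rho>) \<Longrightarrow> \<upsilon> \<le> \<tau> \<Longrightarrow> norm (F (q + u q \<tau>) \<tau>) \<le> b \<tau>"
  using bound shifted_in_ostrip4 by blast

lemma integrand_integrable:
  assumes q: "q \<in> ostrip (2 * \<rho>)" and t: "\<upsilon> \<le> t"
  shows "set_integrable lborel {t..} (\<lambda>\<tau>. F (q + u q \<tau>) \<tau>)"
proof (rule set_integrable_tail[OF _ t], rule set_integrable_bound[OF b_int])
  show "set_borel_measurable lborel {\<upsilon>..} (\<lambda>\<tau>. F (q + u q \<tau>) \<tau>)"
    using set_measurable_continuous_on[OF _ integrand_continuous[OF q]]
    by (simp add: set_borel_measurable_def)
  show "AE \<tau> in lborel. \<tau> \<in> {\<upsilon>..} \<longrightarrow> norm (F (q + u q \<tau>) \<tau>) \<le> norm (b \<tau>)"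
    using integrand_bound[OF q] b_nonneg by auto
qed

lemma picard_norm_le:
  assumes "q \<in> ostrip (2 * \<rho>)" "\<upsilon> \<le> t"
  shows "norm (picard u q t) \<le> tail b t"
  unfolding picard_def norm_minus_cancel
  using assms integrand_bound
  by (intro tail_norm_le integrand_integrable set_integrable_tail[OF b_int]) auto

lemma picard_has_vector_derivative:
  assumes "q \<in> ostrip (2 * \<rho>)" "\<upsilon> \<le> t"
  shows "(picard u q has_vector_derivative F (q + u q t) t) (at t within {\<upsilon>..})"
proof -
  have "((\<lambda>t. - tail (\<lambda>\<tau>. F (q + u q \<tau>) \<tau>) t) has_vector_derivative - (- F (q + u q t) t)) (at t within {\<upsilon>..})"
    using assms by (intro has_vector_derivative_minus tail_has_vector_derivative
        integrand_integrable integrand_continuous) auto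
  then show ?thesis by (simp add: picard_def[abs_def])
qed

lemma picard_holomorphic:
  assumes t: "\<upsilon> \<le> t"
  shows "holomorphic_vec_on (\<lambda>q. picard u q t) (ostrip (2 * \<rho>))"
proof -
  have "holomorphic_vec_on (\<lambda>q. \<integral>\<tau>. indicator {t..} \<tau> *\<^sub>R F (q + u q \<tau>) \<tau> \<partial>lborel) (ostrip (2 * \<rho>))"
  proof (rule holomorphic_vec_on_integral[OF open_ostrip])
    show "holomorphic_vec_on (\<lambda>q. indicator {t..} \<tau> *\<^sub>R F (q + u q \<tau>) \<tau>) (ostrip (2 * \<rho>))" for \<tau>
    proof (cases "t \<le> \<tau>")
      case True
      have "holomorphic_vec_on (\<lambda>q. F (q + u q \<tau>) \<tau>) (ostrip (2 * \<rho>))"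
        using u True t shifted_in_ostrip4
        by (intro holomorphic_vec_on_compose[OF _ hol] holomorphic_vec_on_add holomorphic_vec_on_id)
           (auto simp: admissible_def)
      then show ?thesis using True by simp
    qed (simp add: holomorphic_vec_on_const)
    show "norm (indicator {t..} \<tau> *\<^sub>R F (q + u q \<tau>) \<tau>) \<le> indicator {t..} \<tau> *\<^sub>R b \<tau>"
      if "q \<in> ostrip (2 * \<rho>)" for \<tau> q
      using integrand_bound[OF that] t by (auto simp: indicator_def)
    show "integrable lborel (\<lambda>\<tau>. indicator {t..} \<tau> *\<^sub>R b \<tau>)"
      using set_integrable_tail[OF b_int t] by (simp add: set_integrable_def)
    show "(\<lambda>\<tau>. indicator {t..} \<tau> *\<^sub>R F (q + u q \<tau>) \<tau>) \<in> borel_measurable lborel"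
      if "q \<in> ostrip (2 * \<rho>)" for q
      using integrand_integrable[OF that t] unfolding set_integrable_def
      by (rule borel_measurable_integrable)
  qed
  then show ?thesis
    unfolding picard_def tail_def set_lebesgue_integral_def by (rule holomorphic_vec_on_minus)
qed

lemma picard_admissible: "admissible (picard u)"
  unfolding admissible_def
proof (intro conjI ballI allI impI)
  show "continuous_on {\<upsilon>..} (picard u q)" if "q \<in> ostrip (2 * \<rho>)" for q
    unfolding continuous_on_eq_continuous_within
    using has_vector_derivative_continuous picard_has_vector_derivative[OF that] by (metis atLeast_iff)
  show "norm (picard u q t) \<le> \<rho>" if "q \<in> ostrip (2 * \<rho>)" "\<upsilon> \<le> t" for q t
    using picard_norm_le[OF that] tail_b_antimono[OF order_refl that(2)] tail_b_le rho by simp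
  show "holomorphic_vec_on (\<lambda>q. picard u q t) (ostrip (2 * \<rho>))" if "\<upsilon> \<le> t" for t
    using that by (rule picard_holomorphic)
  show "picard u (q + k) t = picard u q t"
    if q: "q \<in> ostrip (2 * \<rho>)" and k: "k \<in> int_lattice" and t: "\<upsilon> \<le> t" for q k t
  proof -
    have "F (q + k + u (q + k) \<tau>) \<tau> = F (q + u q \<tau>) \<tau>" if "t \<le> \<tau>" for \<tau>
    proof -
      have "u (q + k) \<tau> = u q \<tau>" using u q k t that by (auto simp: admissible_def)
      then have "F (q + k + u (q + k) \<tau>) \<tau> = F ((q + u q \<tau>) + k) \<tau>" by (simp add: algebra_simps)
      also have "\<dots> = F (q + u q \<tau>) \<tau>" using q k t that by (intro per shifted_in_ostrip4) auto
      finally show ?thesis .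
    qed
    then show ?thesis
      unfolding picard_def tail_def by (intro arg_cong[of _ _ uminus] set_lebesgue_integral_cong) auto
  qed
  show "picard u (cvec q) t $ i \<in> \<real>" if t: "\<upsilon> \<le> t" for q i t
  proof -
    have q: "cvec q \<in> ostrip (2 * \<rho>)" using rho by (simp add: cvec_in_ostrip)
    have "F (cvec q + u (cvec q) \<tau>) \<tau> $ i \<in> \<real>" if "t \<le> \<tau>" for \<tau>
    proof -
      have "(cvec q + u (cvec q) \<tau>) $ j \<in> \<real>" for j
        using u t that by (auto simp: admissible_def cvec_real intro!: Reals_add)
      then obtain q' where "cvec q + u (cvec q) \<tau> = cvec q'" by (rule real_vec_cases)
      then show ?thesis using real t that by simp
    qed
    then show ?thesis
      unfolding picard_def
      using tail_real_component[OF integrand_integrable[OF q t]] by simp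
  qed
qed

end

text \<open>The operator contracts for each \<open>q\<close> separately, since it involves \<open>u\<close> only at the same \<open>q\<close>.\<close>
lemma picard_contraction:
  assumes u: "admissible u" and w: "admissible w" and q: "q \<in> ostrip (2 * \<rho>)"
    and e: "\<And>\<tau>. \<upsilon> \<le> \<tau> \<Longrightarrow> norm (u q \<tau> - w q \<tau>) \<le> e" and t: "\<upsilon> \<le> t"
  shows "norm (picard u q t - picard w q t) \<le> e / 2"
proof -
  let ?g = "\<lambda>\<tau>. F (q + u q \<tau>) \<tau> - F (q + w q \<tau>) \<tau>"
  let ?c = "real CARD('n) * 2 / \<rho> * e"
  note i = integrand_integrable[OF u q t] integrand_integrable[OF w q t]
  have e0: "0 \<le> e" using e[of t] t norm_ge_zero order_trans by blast
  have "norm (picard u q t - picard w q t) = norm (tail ?g t)"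
    unfolding picard_def tail_def set_integral_diff(2)[OF i] by (simp add: norm_minus_commute)
  also have "\<dots> \<le> tail (\<lambda>\<tau>. ?c * b \<tau>) t"
  proof (rule tail_norm_le)
    show "set_integrable lborel {t..} ?g" using i by (rule set_integral_diff(1))
    show "set_integrable lborel {t..} (\<lambda>\<tau>. ?c * b \<tau>)"
      using set_integrable_tail[OF b_int t] by simp
    fix \<tau> assume "t \<le> \<tau>"
    then have \<tau>: "\<upsilon> \<le> \<tau>" using t by simp
    have "norm (?g \<tau>) \<le> real CARD('n) * (2 * b \<tau> / \<rho>) * norm ((q + u q \<tau>) - (q + w q \<tau>))"
      using hol[OF \<tau>] bound[OF _ \<tau>] shifted_in_ostrip[OF u q \<tau>] shifted_in_ostrip[OF w q \<tau>] rho
      by (intro holomorphic_strip_lipschitz[where s = "3 * \<rho>"]) auto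
    also have "\<dots> \<le> real CARD('n) * (2 * b \<tau> / \<rho>) * e"
      using e[OF \<tau>] b_nonneg[OF \<tau>] rho by (intro mult_left_mono) auto
    finally show "norm (?g \<tau>) \<le> ?c * b \<tau>" by (simp add: mult_ac)
  qed
  also have "\<dots> = ?c * tail b t" by (simp add: tail_def)
  also have "\<dots> \<le> ?c * tail b \<upsilon>"
    using e0 rho tail_b_antimono[OF order_refl t] by (intro mult_left_mono) auto
  also have "\<dots> = (4 * real CARD('n) * tail b \<upsilon>) * (e / (2 * \<rho>))"
    using rho by (simp add: field_simps)
  also have "\<dots> \<le> \<rho> * (e / (2 * \<rho>))"
    using small e0 rho by (intro mult_right_mono) auto
  finally show ?thesis using rho by simp
qed


lemma picard_time_modulus:
  assumes u: "admissible u" and q: "q \<in> ostrip (2 * \<rho>)" and t: "\<upsilon> \<le> t" "\<upsilon> \<le> t'"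
  shows "norm (picard u q t - picard u q t') \<le> \<bar>tail b t - tail b t'\<bar>"
proof -
  let ?f = "\<lambda>\<tau>. F (q + u q \<tau>) \<tau>"
  have *: "norm (picard u q t - picard u q t') \<le> tail b t - tail b t'"
    if "\<upsilon> \<le> t" "t \<le> t'" for t t'
  proof -
    have i: "?f integrable_on {t..t'}" "b integrable_on {t..t'}"
      using that
      by (auto intro!: set_borel_integral_eq_integral(1)
          set_integrable_subset[OF integrand_integrable[OF u q that(1)]]
          set_integrable_subset[OF b_int])
    have "picard u q t - picard u q t' = - integral {t..t'} ?f"
      using tail_split[OF integrand_integrable[OF u q that(1)] that(2)] by (simp add: picard_def)
    then have "norm (picard u q t - picard u q t') \<le> integral {t..t'} b"
      using i integrand_bound[OF u q] that
      by (auto intro!: Henstock_Kurzweil_Integration.integral_norm_bound_integral)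
    then show ?thesis
      using tail_split[OF set_integrable_tail[OF b_int that(1)] that(2)] by simp
  qed
  show ?thesis
  proof (cases "t \<le> t'")
    case True
    then show ?thesis using *[OF t(1)] abs_ge_self order_trans by blast
  next
    case False
    then show ?thesis
      using *[OF t(2), of t] abs_ge_minus_self[of "tail b t - tail b t'"]
      by (simp add: norm_minus_commute)
  qed
qed

definition iterate :: "nat \<Rightarrow> complex ^ 'n \<Rightarrow> real \<Rightarrow> complex ^ 'n" where
  "iterate n = (picard ^^ n) (\<lambda>q t. 0)"

lemma iterate_0: "iterate 0 q t = 0"
  and iterate_Suc: "iterate (Suc n) = picard (iterate n)"
  by (simp_all add: iterate_def)

lemma iterate_admissible: "admissible (iterate n)"
proof (induction n)
  case 0
  then show ?case using rho
    by (simp add: admissible_def iterate_def holomorphic_vec_on_const)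
next
  case (Suc n)
  then show ?case by (simp add: iterate_Suc picard_admissible)
qed

lemma iterate_step:
  assumes q: "q \<in> ostrip (2 * \<rho>)" and t: "\<upsilon> \<le> t"
  shows "norm (iterate (Suc n) q t - iterate n q t) \<le> \<rho> * (1/2) ^ n"
  using t
proof (induction n arbitrary: t)
  case 0
  then show ?case
    using iterate_admissible[of "Suc 0"] q by (simp add: iterate_0 admissible_def)
next
  case (Suc n)
  have "norm (picard (iterate (Suc n)) q t - picard (iterate n) q t) \<le> (\<rho> * (1/2) ^ n) / 2"
    using Suc by (intro picard_contraction iterate_admissible q) auto
  then show ?case by (simp add: iterate_Suc)
qed

text \<open>The limit of the iterates is written as a telescoping series so that it is an integral against the
  counting measure and \<open>holomorphic_vec_on_integral\<close> applies.\<close>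
definition solution :: "complex ^ 'n \<Rightarrow> real \<Rightarrow> complex ^ 'n" where
  "solution q t = (\<Sum>n. iterate (Suc n) q t - iterate n q t)"

lemma iterate_steps_integrable:
  assumes "q \<in> ostrip (2 * \<rho>)" "\<upsilon> \<le> t"
  shows "integrable (count_space UNIV) (\<lambda>n. iterate (Suc n) q t - iterate n q t)"
  unfolding integrable_count_space_nat_iff
proof (rule summable_comparison_test'[where g = "\<lambda>n. \<rho> * (1/2) ^ n"])
  show "summable (\<lambda>n. \<rho> * (1/2) ^ n)" by (intro summable_mult summable_geometric) simp
qed (use iterate_step[OF assms] in simp)

lemma solution_minus_iterate:
  assumes q: "q \<in> ostrip (2 * \<rho>)" and t: "\<upsilon> \<le> t"
  shows "norm (solution q t - iterate n q t) \<le> 2 * \<rho> * (1/2) ^ n"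
proof -
  let ?d = "\<lambda>n. iterate (Suc n) q t - iterate n q t"
  have s: "summable ?d"
    using sums_integral_count_space_nat[OF iterate_steps_integrable[OF q t]] by (rule sums_summable)
  have "(\<Sum>i<n. ?d i) = iterate n q t"
    by (induction n) (simp_all add: iterate_0)
  then have "solution q t - iterate n q t = (\<Sum>i. ?d (i + n))"
    unfolding solution_def suminf_minus_initial_segment[OF s] by simp
  also have "norm \<dots> \<le> (\<Sum>i. (\<rho> * (1/2) ^ n) * (1/2) ^ i)"
  proof (rule norm_suminf_le)
    show "norm (?d (i + n)) \<le> (\<rho> * (1/2) ^ n) * (1/2) ^ i" for i
      using iterate_step[OF q t, of "i + n"] by (simp add: power_add mult_ac)
  qed (intro summable_mult summable_geometric, simp)
  also have "\<dots> = (\<rho> * (1/2) ^ n) * (1 / (1 - 1/2))"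
    by (subst suminf_mult) (auto simp: suminf_geometric intro: summable_geometric)
  finally show ?thesis by (simp add: mult_ac)
qed

lemma geometric_null: "(\<lambda>n. 2 * \<rho> * (1/2) ^ n) \<longlonglongrightarrow> 0"
  by (intro tendsto_mult_right_zero LIMSEQ_realpow_zero) auto

lemma iterate_uniform_limit:
  assumes q: "q \<in> ostrip (2 * \<rho>)"
  shows "uniform_limit {\<upsilon>..} (\<lambda>n. iterate n q) (solution q) sequentially"
proof (rule uniform_limitI)
  fix e :: real assume "e > 0"
  then have "\<forall>\<^sub>F n in sequentially. 2 * \<rho> * (1/2) ^ n < e"
    using order_tendstoD(2)[OF geometric_null] by blast
  then show "\<forall>\<^sub>F n in sequentially. \<forall>t\<in>{\<upsilon>..}. dist (iterate n q t) (solution q t) < e"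
  proof eventually_elim
    case (elim n)
    show ?case
    proof
      fix t assume "t \<in> {\<upsilon>..}"
      then have "norm (solution q t - iterate n q t) < e"
        using order_le_less_trans[OF solution_minus_iterate[OF q] elim] by simp
      then show "dist (iterate n q t) (solution q t) < e"
        by (simp add: dist_norm norm_minus_commute)
    qed
  qed
qed

lemma iterate_tendsto:
  assumes "q \<in> ostrip (2 * \<rho>)" "\<upsilon> \<le> t"
  shows "(\<lambda>n. iterate n q t) \<longlonglongrightarrow> solution q t"
  using tendsto_uniform_limitI[OF iterate_uniform_limit[OF assms(1)], of t] assms(2) by simp

lemma solution_admissible: "admissible solution"
  unfolding admissible_def
proof (intro conjI ballI allI impI)
  note it = iterate_admissible[unfolded admissible_def]
  show "continuous_on {\<upsilon>..} (solution q)" if "q \<in> ostrip (2 * \<rho>)" for q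
    by (rule uniform_limit_theorem[OF _ iterate_uniform_limit[OF that]]) (use it that in auto)
  show "norm (solution q t) \<le> \<rho>" if "q \<in> ostrip (2 * \<rho>)" "\<upsilon> \<le> t" for q t
    by (rule Lim_norm_ubound[OF _ iterate_tendsto[OF that]]) (use it that in auto)
  show "holomorphic_vec_on (\<lambda>q. solution q t) (ostrip (2 * \<rho>))" if t: "\<upsilon> \<le> t" for t
  proof (rule holomorphic_vec_on_cong[OF _ open_ostrip])
    show "holomorphic_vec_on (\<lambda>q. \<integral>n. iterate (Suc n) q t - iterate n q t \<partial>count_space UNIV)
        (ostrip (2 * \<rho>))"
    proof (rule holomorphic_vec_on_integral[OF open_ostrip])
      show "holomorphic_vec_on (\<lambda>q. iterate (Suc n) q t - iterate n q t) (ostrip (2 * \<rho>))" for n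
        using it t by (intro holomorphic_vec_on_diff) auto
      show "integrable (count_space UNIV) (\<lambda>n. \<rho> * (1/2) ^ n)"
        using rho by (auto simp: integrable_count_space_nat_iff abs_mult power_abs intro: summable_geometric)
    qed (use iterate_step t in auto)
    show "(\<integral>n. iterate (Suc n) q t - iterate n q t \<partial>count_space UNIV) = solution q t"
      if "q \<in> ostrip (2 * \<rho>)" for q
      unfolding solution_def
      using sums_integral_count_space_nat[OF iterate_steps_integrable[OF that t]] by (rule sums_unique)
  qed
  show "solution (q + k) t = solution q t"
    if "q \<in> ostrip (2 * \<rho>)" "k \<in> int_lattice" "\<upsilon> \<le> t" for q k t
    using it that by (simp add: solution_def)
  show "solution (cvec q) t $ i \<in> \<real>" if "\<upsilon> \<le> t" for q i t
  proof (rule closed_sequentially[OF closed_complex_Reals])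
    show "iterate n (cvec q) t $ i \<in> \<real>" for n using it that by blast
    show "(\<lambda>n. iterate n (cvec q) t $ i) \<longlonglongrightarrow> solution (cvec q) t $ i"
      using rho that by (intro tendsto_vec_nth iterate_tendsto cvec_in_ostrip) auto
  qed
qed

lemma solution_fixed_point:
  assumes q: "q \<in> ostrip (2 * \<rho>)" and t: "\<upsilon> \<le> t"
  shows "solution q t = picard solution q t"
proof (rule LIMSEQ_unique)
  show "(\<lambda>n. iterate (Suc n) q t) \<longlonglongrightarrow> solution q t"
    using iterate_tendsto[OF q t] by (rule LIMSEQ_Suc)
  show "(\<lambda>n. iterate (Suc n) q t) \<longlonglongrightarrow> picard solution q t"
  proof (rule LIM_zero_cancel, rule Lim_null_comparison[OF _ geometric_null])
    have "norm (iterate (Suc n) q t - picard solution q t) \<le> (2 * \<rho> * (1/2) ^ n) / 2" for n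
      unfolding iterate_Suc
      using solution_minus_iterate[OF q, of _ n]
      by (intro picard_contraction[OF iterate_admissible solution_admissible q _ t])
         (simp add: norm_minus_commute)
    then show "\<forall>\<^sub>F n in sequentially.
        norm (iterate (Suc n) q t - picard solution q t) \<le> 2 * \<rho> * (1/2) ^ n"
      using rho by (intro always_eventually allI order_trans[OF \<open>\<And>n. norm _ \<le> _\<close>]) simp
  qed
qed

lemma solution_holomorphic: "\<upsilon> \<le> t \<Longrightarrow> holomorphic_vec_on (\<lambda>q. solution q t) (ostrip (2 * \<rho>))"
  using solution_admissible by (simp add: admissible_def)

lemma solution_periodic:
  "q \<in> ostrip (2 * \<rho>) \<Longrightarrow> k \<in> int_lattice \<Longrightarrow> \<upsilon> \<le> t \<Longrightarrow> solution (q + k) t = solution q t"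
  using solution_admissible by (simp add: admissible_def)

lemma solution_real: "\<upsilon> \<le> t \<Longrightarrow> solution (cvec q) t $ i \<in> \<real>"
  using solution_admissible by (simp add: admissible_def)

lemma solution_norm_le: "q \<in> ostrip (2 * \<rho>) \<Longrightarrow> \<upsilon> \<le> t \<Longrightarrow> norm (solution q t) \<le> tail b t"
  using picard_norm_le[OF solution_admissible] solution_fixed_point by simp

lemma solution_time_modulus:
  "q \<in> ostrip (2 * \<rho>) \<Longrightarrow> \<upsilon> \<le> t \<Longrightarrow> \<upsilon> \<le> t' \<Longrightarrow>
    norm (solution q t - solution q t') \<le> \<bar>tail b t - tail b t'\<bar>"
  using picard_time_modulus[OF solution_admissible] solution_fixed_point by simp

lemma solution_has_vector_derivative:
  assumes "q \<in> ostrip (2 * \<rho>)" "\<upsilon> \<le> t"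
  shows "(solution q has_vector_derivative F (q + solution q t) t) (at t within {\<upsilon>..})"
  by (rule has_vector_derivative_transform[OF _ _ picard_has_vector_derivative[OF solution_admissible]])
     (use assms solution_fixed_point in auto)

end

section \<open>From the solution to the torus\<close>

text \<open>By smallness \<open>u\<close> has Lipschitz constant at most one half on the real torus.  If two points have the same
  image up to a lattice vector \<open>k\<close>, then \<open>q\<close> and \<open>q' + k\<close> have exactly the same image, by
  periodicity, and hence coincide.\<close>
lemma near_identity_embedding:
  fixes u :: "complex ^ 'n \<Rightarrow> complex ^ 'n"
  assumes rho: "0 < \<rho>" and hol: "holomorphic_vec_on u (ostrip (2 * \<rho>))"
    and M: "\<And>q. q \<in> ostrip (2 * \<rho>) \<Longrightarrow> norm (u q) \<le> M" and small: "4 * real CARD('n) * M \<le> \<rho>"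
    and per: "\<And>q k. q \<in> ostrip (2 * \<rho>) \<Longrightarrow> k \<in> int_lattice \<Longrightarrow> u (q + k) = u q"
    and real: "\<And>q i. u (cvec q) $ i \<in> \<real>"
  shows "real_analytic_embedding \<rho> (\<lambda>q. q + u q)"
proof -
  have sub: "cstrip \<rho> \<subseteq> (ostrip (2 * \<rho>) :: (complex ^ 'n) set)"
    using rho by (intro cstrip_subset_ostrip) simp
  have hol': "holomorphic_vec_on (\<lambda>q. q + u q) (ostrip (2 * \<rho>))"
    by (intro holomorphic_vec_on_add holomorphic_vec_on_id hol)
  have half: "real CARD('n) * (2 * M / \<rho>) \<le> 1 / 2"
    using small rho by (simp add: field_simps)
  have "real_holomorphic_strip \<rho> (\<lambda>q. q + u q)"
    unfolding real_holomorphic_strip_def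
    using continuous_on_subset[OF holomorphic_vec_on_imp_continuous_on[OF hol'] sub]
      holomorphic_vec_on_subset[OF hol' order_trans[OF interior_subset sub]] real
    by (auto intro: Reals_add cvec_real)
  moreover have "(z + k + u (z + k)) - (z + u z) \<in> int_lattice"
    if "z \<in> cstrip \<rho>" "k \<in> int_lattice" for z k
    using per[OF subsetD[OF sub that(1)] that(2)] that(2) by simp
  moreover have "cvec q - cvec q' \<in> int_lattice"
    if k: "(cvec q + u (cvec q)) - (cvec q' + u (cvec q')) \<in> int_lattice" for q q'
  proof -
    define k where "k = (cvec q + u (cvec q)) - (cvec q' + u (cvec q'))"
    have kl: "k \<in> int_lattice" using that by (simp add: k_def)
    have q: "cvec q \<in> ostrip \<rho>" "cvec q' + k \<in> ostrip \<rho>" "cvec q' \<in> ostrip (2 * \<rho>)"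
      using rho int_lattice_real[OF kl] by (simp_all add: cvec_in_ostrip ostrip_add_real)
    have "cvec q - (cvec q' + k) = u (cvec q' + k) - u (cvec q)"
      using per[OF q(3) kl] by (simp add: k_def algebra_simps)
    also have "norm \<dots> \<le> real CARD('n) * (2 * M / \<rho>) * norm ((cvec q' + k) - cvec q)"
      by (rule holomorphic_strip_lipschitz[where s = \<rho> and r = \<rho>, folded mult_2, OF hol rho M q(2,1)])
    also have "\<dots> \<le> 1 / 2 * norm (cvec q - (cvec q' + k))"
      using half by (subst norm_minus_commute, intro mult_right_mono) auto
    finally have "cvec q = cvec q' + k" by simp
    then show ?thesis using kl by simp
  qed
  moreover have "v = 0"
    if "frechet_derivative (\<lambda>q. q + u q) (at (cvec q)) (cvec v) = 0" for q v
  proof -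
    have q: "cvec q \<in> ostrip \<rho>" using rho by (rule cvec_in_ostrip)
    have ball: "ball (cvec q) \<rho> \<subseteq> ostrip (2 * \<rho>)"
      using ball_subset_ostrip[OF q, of \<rho>] by (simp only: mult_2)
    then obtain D where D: "(u has_derivative D) (at (cvec q))" and lin: "\<And>c v. D (c *s v) = c *s D v"
      using hol rho unfolding holomorphic_vec_on_def by (meson centre_in_ball subsetD)
    have "((\<lambda>q. q + u q) has_derivative (\<lambda>h. h + D h)) (at (cvec q))"
      using D by (intro has_derivative_add has_derivative_ident)
    from frechet_derivative_at[OF this] have "cvec v + D (cvec v) = 0"
      using that by (simp add: fun_eq_iff)
    then have "norm (cvec v) = norm (D (cvec v))"
      by (metis add_eq_0_iff norm_minus_cancel)
    also have "\<dots> \<le> real CARD('n) * (2 * M / \<rho>) * norm (cvec v)"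
      using Cauchy_Frechet(1)[OF holomorphic_vec_on_subset[OF hol ball] rho M[OF subsetD[OF ball]] D lin]
      by (simp add: mult.assoc)
    also have "\<dots> \<le> 1 / 2 * norm (cvec v)"
      using half by (intro mult_right_mono) auto
    finally show "v = 0" by (simp add: cvec_eq_0_iff)
  qed
  ultimately show ?thesis by (auto simp: real_analytic_embedding_def)
qed

text \<open>Joint differentiability of \<open>v\<close> is replaced by the smallness of \<open>v(\<cdot>, \<tau>) - v(\<cdot>, t)\<close>.  This difference is
  holomorphic and bounded by \<open>\<epsilon> \<tau>\<close>, so its increment over the distance \<open>\<bar>\<tau> - t\<bar> norm w\<close> is
  \<open>o(\<tau> - t)\<close> by Cauchy's estimate, and the partial derivatives add up.\<close>
lemma has_vector_derivative_along_translation: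
  fixes v :: "complex ^ 'n \<Rightarrow> real \<Rightarrow> complex ^ 'm" and w :: "complex ^ 'n"
  assumes r: "0 < r" and t: "t \<in> T"
    and hol: "\<And>\<tau>. \<tau> \<in> T \<Longrightarrow> holomorphic_vec_on (\<lambda>q. v q \<tau>) (ostrip (s + r))"
    and modulus: "\<And>q \<tau>. q \<in> ostrip (s + r) \<Longrightarrow> \<tau> \<in> T \<Longrightarrow> norm (v q \<tau> - v q t) \<le> \<epsilon> \<tau>"
    and eps: "(\<epsilon> \<longlongrightarrow> 0) (at t within T)"
    and strip: "\<And>\<tau>. q - \<tau> *\<^sub>R w \<in> ostrip s"
    and d: "(v (q - t *\<^sub>R w) has_vector_derivative d) (at t within T)"
    and D: "((\<lambda>x. v x t) has_derivative D) (at (q - t *\<^sub>R w))"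
  shows "((\<lambda>\<tau>. v (q - \<tau> *\<^sub>R w) \<tau>) has_vector_derivative d - D w) (at t within T)"
proof -
  define c where "c = (\<lambda>\<tau>. q - \<tau> *\<^sub>R w)"
  \<comment> \<open>The mixed increment, which is what separates \<open>v (c \<tau>) \<tau>\<close> from the sum of its two partial increments.\<close>
  define R where "R = (\<lambda>\<tau>. (v (c \<tau>) \<tau> - v (c \<tau>) t) - (v (c t) \<tau> - v (c t) t))"
  have R: "norm (R \<tau>) \<le> real CARD('m) * (2 * \<epsilon> \<tau> / r) * norm ((t - \<tau>) *\<^sub>R w)" if "\<tau> \<in> T" for \<tau>
  proof -
    have "c \<tau> - c t = (t - \<tau>) *\<^sub>R w" by (simp add: c_def algebra_simps)
    moreover have "norm (R \<tau>) \<le> real CARD('m) * (2 * \<epsilon> \<tau> / r) * norm (c \<tau> - c t)"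
      unfolding R_def
      using hol[OF that] hol[OF t] modulus[OF _ that] strip
      by (intro holomorphic_strip_lipschitz[OF _ r] holomorphic_vec_on_diff) (auto simp: c_def)
    ultimately show ?thesis by simp
  qed
  have "(R has_vector_derivative 0) (at t within T)"
    unfolding has_vector_derivative_def has_derivative_iff_norm
  proof (intro conjI)
    have "R t = 0" by (simp add: R_def)
    show "((\<lambda>\<tau>. norm (R \<tau> - R t - (\<tau> - t) *\<^sub>R 0) / norm (\<tau> - t)) \<longlongrightarrow> 0) (at t within T)"
    proof (rule Lim_null_comparison)
      show "((\<lambda>\<tau>. real CARD('m) * (2 * \<epsilon> \<tau> / r) * norm w) \<longlongrightarrow> 0) (at t within T)"
        using eps r by (auto intro!: tendsto_eq_intros)
      show "\<forall>\<^sub>F \<tau> in at t within T. norm (norm (R \<tau> - R t - (\<tau> - t) *\<^sub>R 0) / norm (\<tau> - t))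
          \<le> real CARD('m) * (2 * \<epsilon> \<tau> / r) * norm w"
        unfolding eventually_at_topological
      proof (intro exI[of _ UNIV] conjI ballI impI)
        fix \<tau> assume "\<tau> \<noteq> t" "\<tau> \<in> T"
        then show "norm (norm (R \<tau> - R t - (\<tau> - t) *\<^sub>R 0) / norm (\<tau> - t))
            \<le> real CARD('m) * (2 * \<epsilon> \<tau> / r) * norm w"
          using R[of \<tau>] \<open>R t = 0\<close> by (simp add: divide_le_eq abs_minus_commute mult_ac)
      qed auto
    qed
  qed (simp add: bounded_linear_scaleR_left)
  moreover have "((\<lambda>\<tau>. v (c \<tau>) t) has_vector_derivative - D w) (at t within T)"
  proof -
    have "(c has_vector_derivative - w) (at t within T)"
      unfolding c_def by (auto intro!: derivative_eq_intros)
    from vector_derivative_diff_chain_within[OF this, of "\<lambda>x. v x t" D] D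
    show ?thesis
      by (simp add: o_def c_def has_derivative_at_withinI linear_neg[OF has_derivative_linear[OF D]])
  qed
  moreover have "((\<lambda>\<tau>. v (c t) \<tau> - v (c t) t) has_vector_derivative d - 0) (at t within T)"
    using d by (intro derivative_intros) (auto simp: c_def)
  ultimately have "((\<lambda>\<tau>. R \<tau> + v (c \<tau>) t + (v (c t) \<tau> - v (c t) t)) has_vector_derivative
      0 + - D w + (d - 0)) (at t within T)"
    by (intro has_vector_derivative_add)
  then show ?thesis by (simp add: R_def c_def)
qed

lemma norm_component_le_strip_norm:
  assumes "strip_norm s f \<le> ennreal B" "z \<in> cstrip s" "0 \<le> B"
  shows "norm (f z $ i) \<le> B"
proof -
  have "ennreal (norm (f z $ i)) \<le> strip_norm s f"
    unfolding strip_norm_def using assms(2) by (intro SUP_upper2[of z] SUP_upper2[of i]) auto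
  also have "\<dots> \<le> ennreal B" by fact
  finally show ?thesis using assms(3) by simp
qed

lemma strip_norm_le:
  assumes "\<And>z. z \<in> cstrip s \<Longrightarrow> norm (f z) \<le> B"
  shows "strip_norm s f \<le> ennreal B"
  unfolding strip_norm_def
  using assms by (intro SUP_least ennreal_leI) (meson Finite_Cartesian_Product.norm_nth_le order_trans)

lemma tendsto_ennreal_0:
  assumes "(g \<longlongrightarrow> 0) F" "\<forall>\<^sub>F t in F. f t \<le> ennreal (g t)"
  shows "(f \<longlongrightarrow> 0) F"
proof (rule tendsto_sandwich[of "\<lambda>_. 0", OF _ assms(2)])
  show "((\<lambda>t. ennreal (g t)) \<longlongrightarrow> 0) F" using tendsto_ennrealI[OF assms(1)] by simp
qed auto

lemma antimono_integrable_tendsto_0: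
  fixes f :: "real \<Rightarrow> real"
  assumes pos: "\<And>t. 0 \<le> t \<Longrightarrow> 0 \<le> f t" and anti: "antimono_on {0..} f"
    and f: "set_integrable lborel {0..} f"
  shows "(f \<longlongrightarrow> 0) at_top"
proof (rule Lim_null_comparison)
  have "filterlim (\<lambda>t::real. t - 1) at_top at_top"
    unfolding filterlim_at_top
  proof
    fix c :: real
    show "\<forall>\<^sub>F t in at_top. c \<le> t - 1"
      using eventually_ge_at_top[of "c + 1"] by eventually_elim simp
  qed
  then show "((\<lambda>t. tail f (t - 1)) \<longlongrightarrow> 0) at_top"
    by (rule filterlim_compose[OF tail_tendsto_0[OF f]])
  show "\<forall>\<^sub>F t in at_top. norm (f t) \<le> tail f (t - 1)"
    using eventually_ge_at_top[of 1]
  proof eventually_elim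
    case (elim t)
    have i: "set_integrable lborel {t - 1..} f" using set_integrable_tail[OF f] elim by simp
    have "f t = integral {t - 1..t} (\<lambda>_. f t)" by simp
    also have "\<dots> \<le> integral {t - 1..t} f"
    proof (rule integral_le)
      show "f integrable_on {t - 1..t}"
        by (rule set_borel_integral_eq_integral(1), rule set_integrable_subset[OF i]) auto
    qed (use elim monotone_onD[OF anti] in auto)
    also have "\<dots> \<le> tail f (t - 1)"
    proof -
      have "0 \<le> tail f t" unfolding tail_def set_lebesgue_integral_def
        using elim pos by (intro Bochner_Integration.integral_nonneg) (auto simp: indicator_def)
      then show ?thesis using tail_split[OF i, of t] by simp
    qed
    finally show ?case using pos elim by simp
  qed
qed

lemma KAM_data_perturbation:
  fixes \<omega> :: "real ^ 'n" and P Z :: "complex ^ 'n \<Rightarrow> real \<Rightarrow> complex ^ 'n"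
  assumes s: "0 < s" and P: "P \<in> analytic_space 0 s"
    and B: "\<And>t. 0 \<le> t \<Longrightarrow> strip_norm s (\<lambda>q. P q t) \<le> ennreal (B t)" and B0: "(B \<longlongrightarrow> 0) at_top"
    and Z: "\<And>q t. q \<in> cstrip s \<Longrightarrow> 0 \<le> t \<Longrightarrow> Z q t = cvec \<omega> + P q t"
  shows "KAM_data 0 s \<omega> Z (\<lambda>q t. cvec \<omega>) (\<lambda>q. q)"
proof -
  have cstrip: "cvec q \<in> cstrip s" for q :: "real ^ 'n" using s by (simp add: cvec_def cstrip_def)
  have "real_analytic_fun s (\<lambda>q. Z q t)" if t: "0 \<le> t" for t
  proof -
    have P': "continuous_on (cstrip s) (\<lambda>q. P q t)" "holomorphic_vec_on (\<lambda>q. P q t) (interior (cstrip s))"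
      "\<And>q i. P (cvec q) t $ i \<in> \<real>" "bounded ((\<lambda>q. P q t) ` cstrip s)"
      "\<And>z k. z \<in> cstrip s \<Longrightarrow> k \<in> int_lattice \<Longrightarrow> P (z + k) t = P z t"
      using P t by (auto simp: analytic_space_def real_analytic_fun_def real_holomorphic_strip_def)
    have "continuous_on (cstrip s) (\<lambda>q. Z q t)"
      by (rule continuous_on_eq[OF continuous_on_add[OF continuous_on_const P'(1)]])
         (use Z[OF _ t] in auto)
    moreover have "holomorphic_vec_on (\<lambda>q. Z q t) (interior (cstrip s))"
      by (rule holomorphic_vec_on_cong[where f = "\<lambda>q. cvec \<omega> + P q t"])
         (use P'(2) Z[OF subsetD[OF interior_subset] t] in
           \<open>auto intro!: holomorphic_vec_on_add holomorphic_vec_on_const\<close>)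
    moreover have "Z (cvec q) t $ i \<in> \<real>" for q i
      using Z[OF cstrip t] P'(3) by (auto intro: Reals_add cvec_real)
    moreover have "bounded ((\<lambda>q. Z q t) ` cstrip s)"
    proof -
      have "(\<lambda>q. Z q t) ` cstrip s = (\<lambda>x. cvec \<omega> + x) ` (\<lambda>q. P q t) ` cstrip s"
        using Z[OF _ t] by (auto simp: image_image)
      then show ?thesis using bounded_translation[OF P'(4)] by simp
    qed
    moreover have "Z (z + k) t = Z z t" if "z \<in> cstrip s" "k \<in> int_lattice" for z k
    proof -
      have "z + k \<in> cstrip s"
        using that int_lattice_real[OF that(2)] by (simp add: cstrip_def complex_is_Real_iff)
      then show ?thesis using Z that t P'(5) by simp
    qed
    ultimately show ?thesis by (simp add: real_analytic_fun_def real_holomorphic_strip_def)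
  qed
  moreover have "real_analytic_fun s (\<lambda>q :: complex ^ 'n. cvec \<omega>)"
    by (auto simp: real_analytic_fun_def real_holomorphic_strip_def cvec_real image_constant_conv
        intro: holomorphic_vec_on_const)
  moreover have "real_analytic_embedding s (\<lambda>q :: complex ^ 'n. q)"
    by (auto simp: real_analytic_embedding_def real_holomorphic_strip_def cvec_real cvec_eq_0_iff
        frechet_derivative_ident intro: holomorphic_vec_on_id)
  moreover have "((\<lambda>t. strip_norm s (\<lambda>q. Z q t - cvec \<omega>)) \<longlongrightarrow> 0) at_top"
  proof (rule tendsto_ennreal_0[OF B0])
    show "\<forall>\<^sub>F t in at_top. strip_norm s (\<lambda>q. Z q t - cvec \<omega>) \<le> ennreal (B t)"
      using eventually_ge_at_top[of 0]
    proof eventually_elim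
      case (elim t)
      have "strip_norm s (\<lambda>q. Z q t - cvec \<omega>) = strip_norm s (\<lambda>q. P q t)"
        unfolding strip_norm_def using Z elim by (intro SUP_cong) auto
      then show ?case using B elim by simp
    qed
  qed
  ultimately show ?thesis
    using s by (simp add: KAM_data_def frechet_derivative_ident)
qed

theorem corollaryB:
  fixes \<omega> :: "real ^ 'n" and s\<^sub>0 :: real
    and bP :: "real \<Rightarrow> real"
    and P Z :: "complex ^ 'n \<Rightarrow> real \<Rightarrow> complex ^ 'n"
  assumes "0 < s\<^sub>0" and "s\<^sub>0 < 1"
    and "\<forall>t\<ge>0. 0 < bP t"
    and "antimono_on {0..} bP"
    and "set_integrable lborel {0..} bP"
    and "P \<in> analytic_space 0 s\<^sub>0"
    and "\<forall>t\<ge>0. strip_norm s\<^sub>0 (\<lambda>q. P q t) \<le> ennreal (bP t)"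
    and "\<forall>q\<in>cstrip s\<^sub>0. \<forall>t\<ge>0. Z q t = cvec \<omega> + P q t"
  shows "\<exists>\<psi>. analytic_asymptotic_KAM_torus 0 s\<^sub>0 \<omega> Z (\<lambda>q t. cvec \<omega>) (\<lambda>q. q) \<psi>"
proof -
  define \<rho> where "\<rho> = s\<^sub>0 / 4"
  define b where "b = (\<lambda>t. real CARD('n) * bP t)"
  \<comment> \<open>The translation by \<open>t \<omega>\<close> is real, so it preserves every strip.\<close>
  define F where "F = (\<lambda>q t. P (q + t *\<^sub>R cvec \<omega>) t)"
  have rho: "0 < \<rho>" and s4: "4 * \<rho> = s\<^sub>0" using assms(1) by (simp_all add: \<rho>_def)
  have b_int0: "set_integrable lborel {0..} b" using assms(5) by (simp add: b_def)
  have real_shift: "(t *\<^sub>R cvec \<omega>) $ i \<in> \<real>" for t i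
    using cvec_real[of "t *\<^sub>R \<omega>" i] by (simp add: cvec_scaleR)
  have shift: "q + t *\<^sub>R cvec \<omega> \<in> ostrip s \<longleftrightarrow> q \<in> ostrip s"
    "q - t *\<^sub>R cvec \<omega> \<in> ostrip s \<longleftrightarrow> q \<in> ostrip s" for q t s
    using ostrip_add_real[of "t *\<^sub>R cvec \<omega>" q s] ostrip_add_real[of "(- t) *\<^sub>R cvec \<omega>" q s] real_shift
    by (auto simp: real_shift)
  have sub: "ostrip (4 * \<rho>) \<subseteq> (cstrip s\<^sub>0 :: (complex ^ 'n) set)"
    using ostrip_subset_interior_cstrip interior_subset unfolding s4 by blast

  have "((\<lambda>t. 4 * real CARD('n) * tail b t) \<longlongrightarrow> 0) at_top"
    by (intro tendsto_mult_right_zero tail_tendsto_0[OF b_int0])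
  then have "\<forall>\<^sub>F t in at_top. 4 * real CARD('n) * tail b t < \<rho>"
    using rho by (rule order_tendstoD)
  then obtain \<upsilon> where ups: "0 \<le> \<upsilon>" "4 * real CARD('n) * tail b \<upsilon> \<le> \<rho>"
    unfolding eventually_at_top_linorder by (metis less_imp_le max.cobounded1 max.cobounded2)

  interpret integrable_field F b \<rho> \<upsilon>
  proof
    have P: "continuous_on (cstrip s\<^sub>0 \<times> {0..}) (\<lambda>(q, t). P q t)"
      "\<And>t. 0 \<le> t \<Longrightarrow> real_analytic_fun s\<^sub>0 (\<lambda>q. P q t)"
      using assms(6) by (auto simp: analytic_space_def)
    have "continuous_on (ostrip (4 * \<rho>) \<times> {\<upsilon>..}) (\<lambda>x. (fst x + snd x *\<^sub>R cvec \<omega>, snd x))"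
      by (intro continuous_intros)
    from continuous_on_compose2[OF P(1) this]
    show "continuous_on (ostrip (4 * \<rho>) \<times> {\<upsilon>..}) (\<lambda>(q, t). F q t)"
      using shift(1) sub ups(1) by (force simp: F_def case_prod_unfold)
    fix t assume t: "\<upsilon> \<le> t"
    then have t0: "0 \<le> t" using ups by simp
    note Pt = P(2)[OF t0, unfolded real_analytic_fun_def real_holomorphic_strip_def]
    show "holomorphic_vec_on (\<lambda>q. F q t) (ostrip (4 * \<rho>))"
      unfolding F_def
    proof (rule holomorphic_vec_on_compose[where g = "\<lambda>q. P q t" and T = "ostrip (4 * \<rho>)"])
      show "holomorphic_vec_on (\<lambda>q. P q t) (ostrip (4 * \<rho>))"
        using Pt ostrip_subset_interior_cstrip s4 by (blast intro: holomorphic_vec_on_subset)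
    qed (auto simp: shift intro: holomorphic_vec_on_add holomorphic_vec_on_id holomorphic_vec_on_const)
    show "norm (F q t) \<le> b t" if "q \<in> ostrip (4 * \<rho>)" for q
      unfolding F_def b_def
    proof (rule norm_le_CARD_mult, rule norm_component_le_strip_norm[where f = "\<lambda>q. P q t"])
      show "strip_norm s\<^sub>0 (\<lambda>q. P q t) \<le> ennreal (bP t)" using assms(7) t0 by blast
      show "q + t *\<^sub>R cvec \<omega> \<in> cstrip s\<^sub>0" using that shift(1) sub by blast
      show "0 \<le> bP t" using assms(3) t0 less_imp_le by blast
    qed
    show "F (q + k) t = F q t" if "q \<in> ostrip (4 * \<rho>)" "k \<in> int_lattice" for q k
    proof -
      have "q + t *\<^sub>R cvec \<omega> \<in> cstrip s\<^sub>0" using that(1) shift(1) sub by blast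
      then have "P (q + t *\<^sub>R cvec \<omega> + k) t = P (q + t *\<^sub>R cvec \<omega>) t" using Pt that(2) by blast
      then show ?thesis by (simp add: F_def add_ac)
    qed
    show "F (cvec q) t $ i \<in> \<real>" for q i
    proof -
      have "(cvec q + t *\<^sub>R cvec \<omega>) $ j \<in> \<real>" for j
        using Reals_add[OF cvec_real real_shift] by simp
      then obtain q' where "cvec q + t *\<^sub>R cvec \<omega> = cvec q'" by (rule real_vec_cases)
      then show ?thesis using Pt by (simp add: F_def)
    qed
  qed (use rho ups set_integrable_tail[OF b_int0 ups(1)] in auto)

  define u where "u = (\<lambda>q t. solution (q - t *\<^sub>R cvec \<omega>) t)"
  have u_bound: "norm (u q t) \<le> tail b t" if "q \<in> ostrip (2 * \<rho>)" "\<upsilon> \<le> t" for q t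
    using solution_norm_le that by (simp add: u_def shift)
  have u_holomorphic: "holomorphic_vec_on (\<lambda>q. u q t) (ostrip (2 * \<rho>))" if "\<upsilon> \<le> t" for t
    unfolding u_def
    by (intro holomorphic_vec_on_compose[OF _ solution_holomorphic[OF that]]
        holomorphic_vec_on_diff holomorphic_vec_on_id holomorphic_vec_on_const)
       (simp add: shift)

  have "real_analytic_embedding \<rho> (\<lambda>q. q + u q t)" if t: "\<upsilon> \<le> t" for t
  proof (rule near_identity_embedding[OF rho u_holomorphic[OF t] u_bound[OF _ t]])
    show "4 * real CARD('n) * tail b t \<le> \<rho>"
      using tail_b_antimono[OF order_refl t] by (intro order_trans[OF mult_left_mono ups(2)]) auto
    show "u (q + k) t = u q t" if "q \<in> ostrip (2 * \<rho>)" "k \<in> int_lattice" for q k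
      using solution_periodic[of "q - t *\<^sub>R cvec \<omega>" k t] that t
      by (simp add: u_def shift add_diff_eq diff_add_eq)
    show "u (cvec q) t $ i \<in> \<real>" for q i
      using solution_real[OF t, of "q - t *\<^sub>R \<omega>" i] by (simp add: u_def cvec_diff cvec_scaleR)
  qed
  moreover have "((\<lambda>t. strip_norm \<rho> (\<lambda>q. (q + u q t) - q)) \<longlongrightarrow> 0) at_top"
  proof (rule tendsto_ennreal_0[OF tail_tendsto_0[OF b_int]])
    show "\<forall>\<^sub>F t in at_top. strip_norm \<rho> (\<lambda>q. (q + u q t) - q) \<le> ennreal (tail b t)"
      using eventually_ge_at_top[of \<upsilon>]
      by eventually_elim
         (use u_bound cstrip_subset_ostrip[of \<rho> "2 * \<rho>"] rho in \<open>auto intro!: strip_norm_le\<close>)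
  qed
  moreover have "\<exists>d. ((\<lambda>\<tau>. cvec q + u (cvec q) \<tau>) has_vector_derivative d) (at t within {\<upsilon>..}) \<and>
      Z (cvec q + u (cvec q) t) t
        = frechet_derivative (\<lambda>x. x + u x t) (at (cvec q)) (cvec \<omega>) + d"
    if t: "\<upsilon> \<le> t" for q t
  proof -
    let ?z = "cvec q - t *\<^sub>R cvec \<omega>"
    have q: "cvec q \<in> ostrip \<rho>" "cvec q \<in> ostrip (2 * \<rho>)" using rho by (simp_all add: cvec_in_ostrip)
    obtain D where D: "((\<lambda>x. solution x t) has_derivative D) (at ?z)"
      using solution_holomorphic[OF t] q(2) shift(2) unfolding holomorphic_vec_on_def by blast
    have "((\<lambda>x. x - t *\<^sub>R cvec \<omega>) has_derivative (\<lambda>h. h - 0)) (at (cvec q))"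
      by (intro derivative_intros)
    from has_derivative_compose[OF this D]
    have "((\<lambda>x. x + u x t) has_derivative (\<lambda>h. h + D h)) (at (cvec q))"
      unfolding u_def by (intro has_derivative_add has_derivative_ident) simp
    from frechet_derivative_at[OF this]
    have fd: "frechet_derivative (\<lambda>x. x + u x t) (at (cvec q)) (cvec \<omega>) = cvec \<omega> + D (cvec \<omega>)"
      by (simp add: fun_eq_iff)
    have "((\<lambda>\<tau>. solution (cvec q - \<tau> *\<^sub>R cvec \<omega>) \<tau>) has_vector_derivative
        F (?z + solution ?z t) t - D (cvec \<omega>)) (at t within {\<upsilon>..})"
    proof (rule has_vector_derivative_along_translation[where v = solution and q = "cvec q"
          and w = "cvec \<omega>" and D = D and s = \<rho> and r = \<rho> and \<epsilon> = "\<lambda>\<tau>. \<bar>tail b \<tau> - tail b t\<bar>"])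
      have "continuous (at t within {\<upsilon>..}) (tail b)"
        using tail_continuous_on[OF b_int] t
        by (simp add: continuous_on_eq_continuous_within)
      then show "((\<lambda>\<tau>. \<bar>tail b \<tau> - tail b t\<bar>) \<longlongrightarrow> 0) (at t within {\<upsilon>..})"
        unfolding continuous_within by (intro tendsto_rabs_zero LIM_zero)
    qed (use rho t q D solution_holomorphic solution_time_modulus solution_has_vector_derivative
        in \<open>simp_all add: shift flip: mult_2\<close>)
    then have "((\<lambda>\<tau>. cvec q + u (cvec q) \<tau>) has_vector_derivative
        0 + (F (?z + solution ?z t) t - D (cvec \<omega>))) (at t within {\<upsilon>..})"
      unfolding u_def by (intro has_vector_derivative_add has_vector_derivative_const)
    moreover have "Z (cvec q + u (cvec q) t) t = cvec \<omega> + F (?z + solution ?z t) t"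
    proof -
      have "?z + solution ?z t \<in> ostrip (4 * \<rho>)"
        using shifted_in_ostrip4[OF solution_admissible _ t] q by (simp add: shift)
      then have "(?z + solution ?z t) + t *\<^sub>R cvec \<omega> \<in> cstrip s\<^sub>0"
        using shift(1) sub by blast
      then show ?thesis
        using assms(8) t ups(1) by (simp add: F_def u_def)
    qed
    ultimately show ?thesis using fd by (intro exI conjI) (assumption, simp)
  qed
  moreover have "KAM_data 0 s\<^sub>0 \<omega> Z (\<lambda>q t. cvec \<omega>) (\<lambda>q. q)"
    using assms antimono_integrable_tendsto_0[of bP]
    by (intro KAM_data_perturbation[where P = P and B = bP]) (auto simp: less_imp_le)
  ultimately have "analytic_asymptotic_KAM_torus 0 s\<^sub>0 \<omega> Z (\<lambda>q t. cvec \<omega>) (\<lambda>q. q) (\<lambda>q t. q + u q t)"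
    unfolding analytic_asymptotic_KAM_torus_def
    using rho s4 ups(1) by (intro conjI exI[of _ \<rho>] exI[of _ \<upsilon>]) auto
  then show ?thesis by blast
qed

end
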